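(* Let $G=\langle b_1,b_2,b_3,b_4\rangle\subset U_2(\mathbb{H})$, the primitive quaternionic reflection group of order $720$, isomorphic to $2\cdot A_6$ (the double cover of $A_6$), generated by $$b_1=\begin{pmatrix}1&0\\0&\omega\end{pmatrix},\quad b_2=\begin{pmatrix}\frac{1}{\sqrt3}i&\frac{\sqrt2}{\sqrt3}\\-\frac{\sqrt2}{\sqrt3}&-\frac{1}{\sqrt3}i\end{pmatrix},\quad b_3=\begin{pmatrix}-\frac{\sqrt3}{2}i+\frac12k&0\\0&k\end{pmatrix},\quad b_4=\begin{pmatrix}k&0\\0&-k\end{pmatrix},$$ where $\omega=-\frac12+\frac{\sqrt3}{2}i$. Let $H=\langle b_3,g_2\rangle\cong 2\cdot A_5$ be its reducible subgroup of order $120$, where $$g_2=\begin{pmatrix}\frac{1}{\sqrt3}i & \frac{1}{2\sqrt6}+\frac{1}{2\sqrt2}i+\frac{1}{2\sqrt2}j-\frac{\sqrt3}{2\sqrt2}k\\ \frac{1}{\sqrt6}+\frac{1}{\sqrt2}j & -\frac12+\frac{1}{2\sqrt3}i\end{pmatrix},$$ and let $w,w^\perp\in\mathbb{H}^2$ be the orthogonal vectors $$w=\begin{pmatrix}\sqrt2+\sqrt{10}\\ \sqrt3-i+j+\sqrt3k\end{pmatrix},\qquad w^\perp=\begin{pmatrix}-\sqrt3-i+j+\sqrt3k\\ \sqrt2+\sqrt{10}\end{pmatrix}.$$ Then the $G$-orbits of $w$ and of $w^\perp$ each consist of $720$ distinct vectors which lie in a set of six equiangular lines ($120$ vectors in each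 line), and $H$ fixes the lines $\mathrm{span}_{\mathbb H}\{w\}$ and $\mathrm{span}_{\mathbb H}\{w^\perp\}$, on each of which it has a faithful irreducible action. Further, there is the orthogonal decomposition $$\mathbb{H}^2=\mathrm{span}_{\mathbb H}\{w\}\oplus\mathrm{span}_{\mathbb H}\{w^\perp\}$$ of $\mathbb{H}^2$ into non-isomorphic irreducible $H$-submodules, i.e., these two lines are the homogeneous (isotypic) components of $\mathbb{H}^2$ as an $H$-module.
   Context: $\mathbb{H}$ denotes the quaternions with units $i,j,k$. $\mathbb{H}^d$ is a right $\mathbb{H}$-vector space; matrices act on the left. The inner product is $\langle v,w\rangle=\sum_j\overline{v_j}w_j$, and $U_d(\mathbb{H})$ is the group of $d\times d$ quaternionic matrices preserving it. A line is a one-dimensional right $\mathbb{H}$-subspace $v\mathbb{H}=\mathrm{span}_{\mathbb H}\{v\}$; a matrix $g$ fixes the line if $gv=v\alpha$ for some $\alpha\in\mathbb{H}$. Lines are equiangular if, for unit vectors spanning them, $|\langle v_a,v_b\rangle|^2$ takes the same value for all pairs of distinct lines. A quaternionic reflection is a nonidentity $g\in U_d(\mathbb{H})$ which fixes pointwise a subspace of dimension $d-1$; a quaternionic reflection group is a group generated by quaternionic reflections. A group $G\subset U_d(\mathbb H)$ is irreducible if the only $G$-invariant right $\mathbb{H}$-subspaces are $0$ and $\mathbb{H}^d$, and reducible otherwise. An irreducible group is primitive if $\mathbb{H}^d$ cannot be written as a direct sum of proper nonzero $\mathbb{H}$-subspaces that are permuted by the group. $2\cdot A_n$ denotes the double cover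 of the alternating group $A_n$ (so $2\cdot A_5$ is the binary icosahedral group). An $H$-submodule is an $H$-invariant right $\mathbb{H}$-subspace, with isomorphisms being $\mathbb{H}$-linear and commuting with the $H$-action. *)

theory Defs
  imports "HOL-Analysis.Analysis" "HOL-Algebra.Sym_Groups"
begin

section \<open>Quaternions\<close>

text \<open>\<open>Quat a b c d\<close> is $a + bi + cj + dk$.\<close>

codatatype quat = Quat (QRe: real) (QI: real) (QJ: real) (QK: real)

lemma quat_eqI:
  "\<lbrakk>QRe x = QRe y; QI x = QI y; QJ x = QJ y; QK x = QK y\<rbrakk> \<Longrightarrow> x = y"
  by (rule quat.expand) simp

lemma quat_eq_iff:
  "x = y \<longleftrightarrow> QRe x = QRe y \<and> QI x = QI y \<and> QJ x = QJ y \<and> QK x = QK y"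
  by (auto intro: quat_eqI)

instantiation quat :: ab_group_add
begin

primcorec zero_quat where
  "QRe 0 = 0" | "QI 0 = 0" | "QJ 0 = 0" | "QK 0 = 0"

primcorec plus_quat where
  "QRe (x + y) = QRe x + QRe y"
| "QI (x + y) = QI x + QI y"
| "QJ (x + y) = QJ x + QJ y"
| "QK (x + y) = QK x + QK y"

primcorec uminus_quat where
  "QRe (- x) = - QRe x" | "QI (- x) = - QI x" | "QJ (- x) = - QJ x" | "QK (- x) = - QK x"

primcorec minus_quat where
  "QRe (x - y) = QRe x - QRe y"
| "QI (x - y) = QI x - QI y"
| "QJ (x - y) = QJ x - QJ y"
| "QK (x - y) = QK x - QK y"

instance
  by standard (simp_all add: quat_eq_iff)

end

instantiation quat :: ring_1
begin

primcorec one_quat where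
  "QRe 1 = 1" | "QI 1 = 0" | "QJ 1 = 0" | "QK 1 = 0"

primcorec times_quat where
  "QRe (x * y) = QRe x * QRe y - QI x * QI y - QJ x * QJ y - QK x * QK y"
| "QI (x * y) = QRe x * QI y + QI x * QRe y + QJ x * QK y - QK x * QJ y"
| "QJ (x * y) = QRe x * QJ y - QI x * QK y + QJ x * QRe y + QK x * QI y"
| "QK (x * y) = QRe x * QK y + QI x * QJ y - QJ x * QI y + QK x * QRe y"

instance
  by standard (simp_all add: quat_eq_iff algebra_simps)

end

instantiation quat :: real_algebra_1
begin

primcorec scaleR_quat where
  "QRe (r *\<^sub>R x) = r * QRe x"
| "QI (r *\<^sub>R x) = r * QI x"
| "QJ (r *\<^sub>R x) = r * QJ x"
| "QK (r *\<^sub>R x) = r * QK x"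

instance
  by standard (simp_all add: quat_eq_iff algebra_simps)

end

primcorec qcnj :: "quat \<Rightarrow> quat" where
  "QRe (qcnj x) = QRe x"
| "QI (qcnj x) = - QI x"
| "QJ (qcnj x) = - QJ x"
| "QK (qcnj x) = - QK x"

instantiation quat :: real_inner
begin

definition inner_quat :: "quat \<Rightarrow> quat \<Rightarrow> real" where
  "inner x y = QRe x * QRe y + QI x * QI y + QJ x * QJ y + QK x * QK y"

definition norm_quat :: "quat \<Rightarrow> real" where
  "norm x = sqrt ((QRe x)\<^sup>2 + (QI x)\<^sup>2 + (QJ x)\<^sup>2 + (QK x)\<^sup>2)"

definition sgn_quat :: "quat \<Rightarrow> quat" where
  "sgn_quat x = x /\<^sub>R norm x"

definition dist_quat :: "quat \<Rightarrow> quat \<Rightarrow> real" where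
  "dist_quat x y = norm (x - y)"

definition uniformity_quat :: "(quat \<times> quat) filter" where
  "uniformity_quat = (INF e\<in>{0<..}. principal {(x, y). dist x y < e})"

definition open_quat :: "quat set \<Rightarrow> bool" where
  "open_quat U \<longleftrightarrow> (\<forall>x\<in>U. eventually (\<lambda>(x', y). x' = x \<longrightarrow> y \<in> U) uniformity)"

instance
proof
  fix x y z :: quat and r :: real and U :: "quat set"
  show "sgn x = x /\<^sub>R norm x" by (rule sgn_quat_def)
  show "dist x y = norm (x - y)" by (rule dist_quat_def)
  show "(uniformity :: (quat \<times> quat) filter) = (INF e\<in>{0<..}. principal {(x, y). dist x y < e})"
    by (rule uniformity_quat_def)
  show "open U \<longleftrightarrow> (\<forall>x\<in>U. eventually (\<lambda>(x', y). x' = x \<longrightarrow> y \<in> U) uniformity)"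
    by (rule open_quat_def)
  show "inner x y = inner y x" "inner (x + y) z = inner x z + inner y z"
    "inner (r *\<^sub>R x) y = r * inner x y"
    by (simp_all add: inner_quat_def algebra_simps)
  show "0 \<le> inner x x"
    by (simp add: inner_quat_def)
  show "inner x x = 0 \<longleftrightarrow> x = 0"
  proof
    assume "inner x x = 0"
    then have "(QRe x)\<^sup>2 + (QI x)\<^sup>2 + (QJ x)\<^sup>2 + (QK x)\<^sup>2 = 0"
      by (simp add: inner_quat_def power2_eq_square)
    then have "(QRe x)\<^sup>2 = 0 \<and> (QI x)\<^sup>2 = 0 \<and> (QJ x)\<^sup>2 = 0 \<and> (QK x)\<^sup>2 = 0"
      by (simp add: add_nonneg_eq_0_iff)
    then show "x = 0" by (simp add: quat_eq_iff)
  qed (simp add: inner_quat_def)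
  show "norm x = sqrt (inner x x)"
    by (simp add: norm_quat_def inner_quat_def power2_eq_square)
qed

end

instantiation quat :: real_normed_div_algebra
begin

definition inverse_quat :: "quat \<Rightarrow> quat" where
  "inverse x = (1 / (norm x)\<^sup>2) *\<^sub>R qcnj x"

definition divide_quat :: "quat \<Rightarrow> quat \<Rightarrow> quat" where
  "divide_quat x y = x * inverse y"

lemma quat_norm_sq: "(norm (x::quat))\<^sup>2 = (QRe x)\<^sup>2 + (QI x)\<^sup>2 + (QJ x)\<^sup>2 + (QK x)\<^sup>2"
  by (simp add: norm_quat_def)

lemma qcnj_mult_self: "qcnj x * x = (norm x)\<^sup>2 *\<^sub>R 1" "x * qcnj x = (norm x)\<^sup>2 *\<^sub>R 1"
  by (simp_all add: quat_eq_iff quat_norm_sq) (simp_all add: power2_eq_square algebra_simps)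

instance
proof
  fix x y :: quat
  show "x \<noteq> 0 \<Longrightarrow> inverse x * x = 1" "x \<noteq> 0 \<Longrightarrow> x * inverse x = 1"
    by (simp_all add: inverse_quat_def qcnj_mult_self)
  show "x div y = x * inverse y" by (rule divide_quat_def)
  show "inverse (0::quat) = 0"
    by (simp add: inverse_quat_def)
  have "(norm (x * y))\<^sup>2 = (norm x * norm y)\<^sup>2"
    by (simp add: quat_norm_sq power_mult_distrib) (simp add: power2_eq_square algebra_simps)
  then show "norm (x * y) = norm x * norm y"
    by (simp add: power2_eq_iff_nonneg)
qed

end


section \<open>The right quaternionic space and its subspaces\<close>

text \<open>Matrices act on column vectors on the left by \<open>(*v)\<close>, and scalars act on the right.
  The library's \<open>subspace\<close>, \<open>span\<close>, \<open>dim\<close> are for left modules over commutative rings (the real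
  structure in the case of \<open>quat ^ 'n\<close>), so their right quaternionic analogues are introduced.\<close>

definition rscale :: "quat ^ 'n \<Rightarrow> quat \<Rightarrow> quat ^ 'n"  (infixl \<open>\<cdot>\<close> 75) where
  "v \<cdot> a = (\<chi> i. v $ i * a)"

definition qinner :: "quat ^ 'n \<Rightarrow> quat ^ 'n \<Rightarrow> quat" where
  "qinner v w = (\<Sum>i\<in>UNIV. qcnj (v $ i) * w $ i)"

definition right_subspace :: "(quat ^ 'n) set \<Rightarrow> bool" where
  "right_subspace S \<longleftrightarrow>
     0 \<in> S \<and> (\<forall>v\<in>S. \<forall>w\<in>S. v + w \<in> S) \<and> (\<forall>v\<in>S. \<forall>a. v \<cdot> a \<in> S)"

definition right_span :: "(quat ^ 'n) set \<Rightarrow> (quat ^ 'n) set" where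
  "right_span B = right_subspace hull B"

definition right_independent :: "(quat ^ 'n) set \<Rightarrow> bool" where
  "right_independent B \<longleftrightarrow>
     (\<forall>F c. finite F \<and> F \<subseteq> B \<and> (\<Sum>v\<in>F. v \<cdot> c v) = 0 \<longrightarrow> (\<forall>v\<in>F. c v = 0))"

definition has_right_dim :: "(quat ^ 'n) set \<Rightarrow> nat \<Rightarrow> bool" where
  "has_right_dim S m \<longleftrightarrow>
     (\<exists>B. finite B \<and> card B = m \<and> right_independent B \<and> right_span B = S)"

definition is_line :: "(quat ^ 'n) set \<Rightarrow> bool" where
  "is_line L \<longleftrightarrow> right_subspace L \<and> has_right_dim L 1"

text \<open>The matrix \<open>g\<close> fixes the line spanned by \<open>v\<close>.\<close>

definition fixes_line :: "quat ^ 'n ^ 'n \<Rightarrow> quat ^ 'n \<Rightarrow> bool" where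
  "fixes_line g v \<longleftrightarrow> (\<exists>a. g *v v = v \<cdot> a)"

definition equiangular :: "(quat ^ 'n) set set \<Rightarrow> bool" where
  "equiangular \<L> \<longleftrightarrow> (\<forall>L\<in>\<L>. is_line L) \<and>
     (\<exists>c::real. \<forall>L\<in>\<L>. \<forall>M\<in>\<L>. L \<noteq> M \<longrightarrow>
        (\<forall>v w. qinner v v = 1 \<and> qinner w w = 1 \<and> right_span {v} = L \<and> right_span {w} = M
           \<longrightarrow> (norm (qinner v w))\<^sup>2 = c))"

definition orthogonal_sets :: "(quat ^ 'n) set \<Rightarrow> (quat ^ 'n) set \<Rightarrow> bool" where
  "orthogonal_sets S T \<longleftrightarrow> (\<forall>v\<in>S. \<forall>w\<in>T. qinner v w = 0)"

text \<open>\<open>W\<close> is the internal direct sum of the finite family \<open>\<V>\<close>. The summands are indexed by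
  themselves, so this covers only families of pairwise distinct subspaces; this is no restriction
  for nonzero summands.\<close>

definition is_direct_sum :: "(quat ^ 'n) set set \<Rightarrow> (quat ^ 'n) set \<Rightarrow> bool" where
  "is_direct_sum \<V> W \<longleftrightarrow>
     finite \<V> \<and> (\<forall>V\<in>\<V>. right_subspace V) \<and>
     W = {\<Sum>V\<in>\<V>. f V | f. f \<in> (\<Pi>\<^sub>E V\<in>\<V>. V)} \<and>
     (\<forall>v\<in>W. \<exists>!f. f \<in> (\<Pi>\<^sub>E V\<in>\<V>. V) \<and> v = (\<Sum>V\<in>\<V>. f V))"


section \<open>Quaternionic matrix groups\<close>

definition unitary_group :: "(quat ^ 'n ^ 'n) monoid" where
  "unitary_group =
     \<lparr>carrier = {g. \<forall>v w. qinner (g *v v) (g *v w) = qinner v w}, mult = (**), one = mat 1\<rparr>"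

abbreviation unitary_subgroup :: "(quat ^ 'n ^ 'n) set \<Rightarrow> (quat ^ 'n ^ 'n) monoid" where
  "unitary_subgroup G \<equiv> unitary_group\<lparr>carrier := G\<rparr>"

definition orbit_of :: "(quat ^ 'n ^ 'n) set \<Rightarrow> quat ^ 'n \<Rightarrow> (quat ^ 'n) set" where
  "orbit_of G v = (\<lambda>g. g *v v) ` G"

definition invariant :: "(quat ^ 'n ^ 'n) set \<Rightarrow> (quat ^ 'n) set \<Rightarrow> bool" where
  "invariant G S \<longleftrightarrow> (\<forall>g\<in>G. \<forall>v\<in>S. g *v v \<in> S)"

definition is_reflection :: "quat ^ 'n ^ 'n \<Rightarrow> bool" where
  "is_reflection g \<longleftrightarrow> g \<in> carrier unitary_group \<and> g \<noteq> mat 1 \<and>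
     (\<exists>S. right_subspace S \<and> has_right_dim S (CARD('n) - 1) \<and> (\<forall>v\<in>S. g *v v = v))"

definition is_reflection_group :: "(quat ^ 'n ^ 'n) set \<Rightarrow> bool" where
  "is_reflection_group G \<longleftrightarrow>
     (\<exists>R. (\<forall>g\<in>R. is_reflection g) \<and> G = generate unitary_group R)"

definition irreducible_group :: "(quat ^ 'n ^ 'n) set \<Rightarrow> bool" where
  "irreducible_group G \<longleftrightarrow>
     (\<forall>S. right_subspace S \<and> invariant G S \<longrightarrow> S = {0} \<or> S = UNIV)"

definition primitive_group :: "(quat ^ 'n ^ 'n) set \<Rightarrow> bool" where
  "primitive_group G \<longleftrightarrow> irreducible_group G \<and>
     \<not> (\<exists>\<V>. is_direct_sum \<V> UNIV \<and> (\<forall>V\<in>\<V>. V \<noteq> {0} \<and> V \<noteq> UNIV) \<and>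
            (\<forall>g\<in>G. \<forall>V\<in>\<V>. (\<lambda>v. g *v v) ` V \<in> \<V>))"

text \<open>\<open>K\<close> is a double cover $2 \cdot A_n$: a stem extension of the alternating group \<open>A\<^sub>n\<close> by a
  group of order 2, i.e. the kernel is central and lies in the commutator subgroup (this excludes
  the split extension \<open>2 \<times> A\<^sub>n\<close>). For \<open>n \<ge> 4\<close> this determines \<open>K\<close> up to isomorphism.\<close>

definition is_double_cover_alt :: "nat \<Rightarrow> ('a, 'b) monoid_scheme \<Rightarrow> bool" where
  "is_double_cover_alt n K \<longleftrightarrow> group K \<and>
     (\<exists>Z. subgroup Z K \<and> card Z = 2 \<and>
        (\<forall>z\<in>Z. \<forall>x\<in>carrier K. z \<otimes>\<^bsub>K\<^esub> x = x \<otimes>\<^bsub>K\<^esub> z) \<and>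
        Z \<subseteq> derived K (carrier K) \<and>
        (K Mod Z) \<cong> alt_group n)"


section \<open>Submodules and homogeneous components\<close>

definition submodule_of :: "(quat ^ 'n ^ 'n) set \<Rightarrow> (quat ^ 'n) set \<Rightarrow> bool" where
  "submodule_of H S \<longleftrightarrow> right_subspace S \<and> invariant H S"

definition irreducible_submodule :: "(quat ^ 'n ^ 'n) set \<Rightarrow> (quat ^ 'n) set \<Rightarrow> bool" where
  "irreducible_submodule H S \<longleftrightarrow> submodule_of H S \<and> S \<noteq> {0} \<and>
     (\<forall>T. submodule_of H T \<and> T \<subseteq> S \<longrightarrow> T = {0} \<or> T = S)"

definition faithful_on :: "(quat ^ 'n ^ 'n) set \<Rightarrow> (quat ^ 'n) set \<Rightarrow> bool" where
  "faithful_on H S \<longleftrightarrow> (\<forall>h\<in>H. (\<forall>v\<in>S. h *v v = v) \<longrightarrow> h = mat 1)"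

definition isomorphic_submodules ::
    "(quat ^ 'n ^ 'n) set \<Rightarrow> (quat ^ 'n) set \<Rightarrow> (quat ^ 'n) set \<Rightarrow> bool" where
  "isomorphic_submodules H S T \<longleftrightarrow>
     (\<exists>\<phi>. bij_betw \<phi> S T \<and>
        (\<forall>v\<in>S. \<forall>w\<in>S. \<phi> (v + w) = \<phi> v + \<phi> w) \<and>
        (\<forall>v\<in>S. \<forall>a. \<phi> (v \<cdot> a) = \<phi> v \<cdot> a) \<and>
        (\<forall>h\<in>H. \<forall>v\<in>S. \<phi> (h *v v) = h *v \<phi> v))"

definition homogeneous_component ::
    "(quat ^ 'n ^ 'n) set \<Rightarrow> (quat ^ 'n) set \<Rightarrow> (quat ^ 'n) set" where
  "homogeneous_component H S =
     right_span (\<Union>{T. submodule_of H T \<and> isomorphic_submodules H S T})"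

definition homogeneous_components :: "(quat ^ 'n ^ 'n) set \<Rightarrow> (quat ^ 'n) set set" where
  "homogeneous_components H = {homogeneous_component H S | S. irreducible_submodule H S}"


section \<open>The specific matrices and vectors\<close>

definition mat2 :: "quat \<Rightarrow> quat \<Rightarrow> quat \<Rightarrow> quat \<Rightarrow> quat ^ 2 ^ 2" where
  "mat2 a b c d = vector [vector [a, b], vector [c, d]]"

definition b1 :: "quat ^ 2 ^ 2" where
  "b1 = mat2 1 0
             0 (Quat (- 1 / 2) (sqrt 3 / 2) 0 0)"

definition b2 :: "quat ^ 2 ^ 2" where
  "b2 = mat2 (Quat 0 (1 / sqrt 3) 0 0)           (Quat (sqrt 2 / sqrt 3) 0 0 0)
             (Quat (- (sqrt 2 / sqrt 3)) 0 0 0)  (Quat 0 (- (1 / sqrt 3)) 0 0)"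

definition b3 :: "quat ^ 2 ^ 2" where
  "b3 = mat2 (Quat 0 (- (sqrt 3 / 2)) 0 (1 / 2)) 0
             0                                   (Quat 0 0 0 1)"

definition b4 :: "quat ^ 2 ^ 2" where
  "b4 = mat2 (Quat 0 0 0 1) 0
             0              (Quat 0 0 0 (- 1))"

definition g2 :: "quat ^ 2 ^ 2" where
  "g2 = mat2
     (Quat 0 (1 / sqrt 3) 0 0)
     (Quat (1 / (2 * sqrt 6)) (1 / (2 * sqrt 2)) (1 / (2 * sqrt 2)) (- (sqrt 3 / (2 * sqrt 2))))
     (Quat (1 / sqrt 6) 0 (1 / sqrt 2) 0)
     (Quat (- 1 / 2) (1 / (2 * sqrt 3)) 0 0)"

definition w_vec :: "quat ^ 2" where
  "w_vec = vector [Quat (sqrt 2 + sqrt 10) 0 0 0, Quat (sqrt 3) (- 1) 1 (sqrt 3)]"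

definition w_perp :: "quat ^ 2" where
  "w_perp = vector [Quat (- sqrt 3) (- 1) 1 (sqrt 3), Quat (sqrt 2 + sqrt 10) 0 0 0]"

end

theory Submission
  imports Defs
begin

text \<open>The Hermitian traceless \<open>2 \<times> 2\<close> quaternionic matrices form a Euclidean space of dimension five on
  which unitary matrices act by conjugation. The line of \<open>w\<close> is an eigenline of such a matrix, and under
  \<open>G\<close> this matrix has exactly six images, the vertices of a regular simplex, which the generators permute
  evenly. A unitary matrix commuting with all vertices commutes with the whole space and is \<open>\<plusminus>1\<close>; as
  explicit words give all three-cycles, \<open>G\<close> is the full preimage of the alternating group of the six
  vertices and \<open>H\<close> is the preimage of the stabilizer of one vertex. The six lines are the eigenlines of the
  vertices for the eigenvalue \<open>\<surd>5\<close> (for \<open>w\<close>) or \<open>-\<surd>5\<close> (for \<open>w\<^sup>\<bottom>\<close>). Point stabilizers are trivial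
  by a Galois argument: up to conjugation the entries of \<open>G\<close> lie in a rational quaternion algebra,
  whereas \<open>w = x + \<surd>5 y\<close> with rational \<open>x\<close>, \<open>y\<close> spanning the plane, so fixing \<open>w\<close> means fixing both.\<close>

section \<open>Quaternionic matrices of size two\<close>

text \<open>Behind the simplex stands the double cover Sp(2) -> SO(5) with kernel \<plusminus>1; the
  rotation group of a regular simplex in dimension five is the alternating group of its six
  vertices. This avoids enumerating 720 matrices: the generators of \<open>G\<close> and
  \<open>H\<close> meet the simplex in thirty matrix identities, and orders, generation and the stem
  property become computations with permutations of six letters. What permutations cannot see is the
  sign of a lift; it is controlled by \<open>b3\<close>, which squares to -1, so that either lift of
  its permutation produces -1. Each vertex squares to 5 and any two distinct vertices have the same
  anticommutator, which yields both the eigenvalues \<plusminus>sqrt 5 and the common angle. Since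
  scalars act on the right, the scalar of a matrix on an invariant line is defined only up to
  conjugation; its real part survives, and this is what separates the two lines under
  \<open>H\<close>.\<close>

lemma qcnj_simps [simp]:
  "qcnj 0 = 0" "qcnj 1 = 1" "qcnj (- x) = - qcnj x" "qcnj (qcnj x) = x"
  "qcnj (x + y) = qcnj x + qcnj y" "qcnj (x - y) = qcnj x - qcnj y"
  "qcnj (x * y) = qcnj y * qcnj x" "qcnj (r *\<^sub>R x) = r *\<^sub>R qcnj x"
  by (simp_all add: quat_eq_iff algebra_simps)

lemma qcnj_eq_0_iff [simp]: "qcnj x = 0 \<longleftrightarrow> x = 0"
  by (auto simp: quat_eq_iff)

lemma norm_qcnj [simp]: "norm (qcnj x) = norm x"
  by (simp add: norm_quat_def)

lemma scaleR_1_eq_iff [simp]: "r *\<^sub>R (1 :: quat) = s *\<^sub>R 1 \<longleftrightarrow> r = s" "r *\<^sub>R (1 :: quat) = 1 \<longleftrightarrow> r = 1"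
  by (auto simp: quat_eq_iff)

lemma mat2_nth [simp]:
  "mat2 a b c d $ 1 $ 1 = a" "mat2 a b c d $ 1 $ 2 = b"
  "mat2 a b c d $ 2 $ 1 = c" "mat2 a b c d $ 2 $ 2 = d"
  by (simp_all add: mat2_def)

lemma mat2_eq_iff:
  "g = (h :: 'a ^ 2 ^ 2) \<longleftrightarrow>
     g $ 1 $ 1 = h $ 1 $ 1 \<and> g $ 1 $ 2 = h $ 1 $ 2 \<and> g $ 2 $ 1 = h $ 2 $ 1 \<and> g $ 2 $ 2 = h $ 2 $ 2"
  by (auto simp: vec_eq_iff forall_2)

lemma vec2_eq_iff: "v = (w :: 'a ^ 2) \<longleftrightarrow> v $ 1 = w $ 1 \<and> v $ 2 = w $ 2"
  by (simp add: vec_eq_iff forall_2)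

lemma mult_nth_2 [simp]:
  "(g ** h) $ i $ j = g $ i $ 1 * h $ 1 $ j + g $ i $ 2 * h $ 2 $ j" for g h :: "quat ^ 2 ^ 2"
  by (simp add: matrix_matrix_mult_def sum_2)

lemma mult_vec_nth_2 [simp]: "(g *v v) $ i = g $ i $ 1 * v $ 1 + g $ i $ 2 * v $ 2"
  for g :: "quat ^ 2 ^ 2"
  by (simp add: matrix_vector_mult_def sum_2)

lemma mat_nth_2 [simp]:
  "mat x $ 1 $ 1 = x" "mat x $ 1 $ (2 :: 2) = 0" "mat x $ 2 $ (1 :: 2) = 0" "mat x $ (2 :: 2) $ 2 = x"
  by (simp_all add: mat_def)

lemma rscale_nth [simp]: "(v \<cdot> a) $ i = v $ i * a"
  by (simp add: rscale_def)

lemma rscale_simps [simp]: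
  "v \<cdot> 1 = v" "v \<cdot> 0 = 0" "0 \<cdot> a = 0" "v \<cdot> (a + b) = v \<cdot> a + v \<cdot> b" "(v + w) \<cdot> a = v \<cdot> a + w \<cdot> a"
  "(v - w) \<cdot> a = v \<cdot> a - w \<cdot> a" "v \<cdot> a \<cdot> b = v \<cdot> (a * b)"
  by (simp_all add: vec_eq_iff algebra_simps)

lemma rscale_eq_0_iff [simp]: "v \<cdot> a = 0 \<longleftrightarrow> v = 0 \<or> a = 0"
  by (auto simp: vec_eq_iff)

lemma matrix_vector_rscale: "g *v (v \<cdot> a) = (g *v v) \<cdot> a" for g :: "quat ^ 'n ^ 'm"
  by (simp add: vec_eq_iff matrix_vector_mult_def sum_distrib_right mult.assoc)

lemma matrix_vector_scaleR: "g *v (r *\<^sub>R v) = r *\<^sub>R (g *v v)" for g :: "quat ^ 'n ^ 'm"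
  by (simp add: vec_eq_iff matrix_vector_mult_def scaleR_right.sum)

lemma qinner_2: "qinner v w = qcnj (v $ 1) * w $ 1 + qcnj (v $ 2) * w $ 2" for v w :: "quat ^ 2"
  by (simp add: qinner_def sum_2)

lemma qinner_simps:
  "qinner (v + v') w = qinner v w + qinner v' w" "qinner v (w + w') = qinner v w + qinner v w'"
  "qinner (v \<cdot> a) w = qcnj a * qinner v w" "qinner v (w \<cdot> a) = qinner v w * a"
  "qinner (r *\<^sub>R v) w = r *\<^sub>R qinner v w" "qinner v (r *\<^sub>R w) = r *\<^sub>R qinner v w"
  "qinner 0 w = 0" "qinner v 0 = 0" "qinner v (- w) = - qinner v w"
  by (simp_all add: qinner_def algebra_simps sum_negf sum.distrib sum_distrib_left sum_distrib_right scaleR_right.sum)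

lemma qcnj_qinner: "qcnj (qinner v w) = qinner w v" for v w :: "quat ^ 2"
  by (simp add: qinner_2)

lemma qinner_self: "qinner v v = ((norm (v $ 1))\<^sup>2 + (norm (v $ 2))\<^sup>2) *\<^sub>R 1" for v :: "quat ^ 2"
  by (simp add: qinner_2 qcnj_mult_self scaleR_add_left)

lemma qinner_self_eq_0_iff [simp]: "qinner v v = 0 \<longleftrightarrow> v = 0" for v :: "quat ^ 2"
  by (simp add: qinner_self vec2_eq_iff add_nonneg_eq_0_iff)

section \<open>Conjugate transpose and the unitary group of the plane\<close>

definition ctrans :: "quat ^ 'n ^ 'm \<Rightarrow> quat ^ 'm ^ 'n" where
  "ctrans g = (\<chi> i j. qcnj (g $ j $ i))"

lemma ctrans_nth [simp]: "ctrans g $ i $ j = qcnj (g $ j $ i)"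
  by (simp add: ctrans_def)

lemma ctrans_simps [simp]: "ctrans (ctrans g) = g" "ctrans (mat 1) = mat 1" "ctrans (- g) = - ctrans g"
  by (auto simp: vec_eq_iff mat_def)

lemma ctrans_mult: "ctrans (g ** h) = ctrans h ** ctrans g" for g h :: "quat ^ 2 ^ 2"
  by (simp add: mat2_eq_iff)

lemma qinner_ctrans: "qinner (g *v v) w = qinner v (ctrans g *v w)" for g :: "quat ^ 2 ^ 2"
  by (simp add: qinner_2 algebra_simps)

text \<open>Multiplicativity of the norm stands in for a determinant: column orthogonality gives
  |a||b| = |c||d|, and with unit columns this forces |a| = |d|. It makes a left inverse
  \<open>ctrans g\<close> a right inverse.\<close>

lemma quat_row_orthonormal:
  fixes a b c d :: quat
  assumes "(norm a)\<^sup>2 + (norm c)\<^sup>2 = 1" "(norm b)\<^sup>2 + (norm d)\<^sup>2 = 1" "qcnj a * b + qcnj c * d = 0"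
  shows "(norm a)\<^sup>2 + (norm b)\<^sup>2 = 1" "a * qcnj c + b * qcnj d = 0"
proof -
  have eq: "qcnj a * b = - (qcnj c * d)"
    using assms(3) by (simp add: eq_neg_iff_add_eq_0)
  then have "norm a * norm b = norm c * norm d"
    by (metis norm_minus_cancel norm_mult norm_qcnj)
  then have "(norm a)\<^sup>2 * (norm b)\<^sup>2 = (norm c)\<^sup>2 * (norm d)\<^sup>2"
    by (metis power_mult_distrib)
  then show sum: "(norm a)\<^sup>2 + (norm b)\<^sup>2 = 1"
    using assms(1,2) by algebra
  then have ad: "(norm a)\<^sup>2 = (norm d)\<^sup>2"
    using assms(2) by linarith
  \<comment> \<open>Multiplying the column relation by \<open>a\<close> on the left and
    \<open>qcnj d\<close> on the right pulls out the central factors |a|^2 and |d|^2, which agree.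
    If they vanish, so do both terms of the claim.\<close>
  have "a * (qcnj a * b) * qcnj d = - (a * qcnj c * (d * qcnj d))"
    by (simp add: eq mult.assoc)
  then have "(norm a)\<^sup>2 *\<^sub>R (b * qcnj d) = - ((norm a)\<^sup>2 *\<^sub>R (a * qcnj c))"
    by (simp add: qcnj_mult_self ad flip: mult.assoc)
  then have "(norm a)\<^sup>2 *\<^sub>R (a * qcnj c + b * qcnj d) = 0"
    by (simp add: scaleR_right_distrib)
  then show "a * qcnj c + b * qcnj d = 0"
    using ad by (cases "a = 0") auto
qed

lemma ctrans_left_inverse_imp_right:
  fixes g :: "quat ^ 2 ^ 2"
  assumes "ctrans g ** g = mat 1" shows "g ** ctrans g = mat 1"
proof -
  let ?a = "g $ 1 $ 1" and ?b = "g $ 1 $ 2" and ?c = "g $ 2 $ 1" and ?d = "g $ 2 $ 2"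
  have *: "(norm ?a)\<^sup>2 + (norm ?c)\<^sup>2 = 1" "(norm ?b)\<^sup>2 + (norm ?d)\<^sup>2 = 1"
      "qcnj ?a * ?b + qcnj ?c * ?d = 0"
    using assms by (simp_all add: mat2_eq_iff qcnj_mult_self flip: scaleR_add_left)
  have "(norm ?c)\<^sup>2 + (norm ?d)\<^sup>2 = 1"
    using * quat_row_orthonormal(1)[OF *] by simp
  moreover have "?c * qcnj ?a + ?d * qcnj ?b = 0"
    using arg_cong[OF quat_row_orthonormal(2)[OF *], of qcnj] by simp
  ultimately show ?thesis
    using quat_row_orthonormal[OF *]
    by (simp add: mat2_eq_iff qcnj_mult_self flip: scaleR_add_left)
qed

lemma unitary_group_simps [simp]: "mult unitary_group = (**)" "one unitary_group = mat 1"
  by (simp_all add: unitary_group_def)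

lemma in_unitary_group_iff:
  "g \<in> carrier unitary_group \<longleftrightarrow> ctrans g ** g = mat 1" for g :: "quat ^ 2 ^ 2"
proof
  assume g: "g \<in> carrier unitary_group"
  have "(ctrans g ** g) *v w = w" for w
  proof -
    have "qinner v ((ctrans g ** g) *v w - w) = 0" for v
      using g by (simp add: unitary_group_def qinner_ctrans qinner_2 algebra_simps
          flip: matrix_vector_mul_assoc)
    then show ?thesis
      using qinner_self_eq_0_iff by (metis eq_iff_diff_eq_0)
  qed
  then show "ctrans g ** g = mat 1"
    by (simp add: matrix_eq)
qed (simp add: unitary_group_def qinner_ctrans matrix_vector_mul_assoc)

lemma unitary_cancel:
  fixes g h :: "quat ^ 2 ^ 2"
  assumes "g \<in> carrier unitary_group"
  shows "ctrans g ** g = mat 1" "g ** ctrans g = mat 1"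
    "ctrans g ** (g ** h) = h" "g ** (ctrans g ** h) = h"
    "ctrans g *v (g *v v) = v" "g *v (ctrans g *v v) = v"
proof -
  show *: "ctrans g ** g = mat 1" "g ** ctrans g = mat 1"
    using assms by (simp_all add: in_unitary_group_iff ctrans_left_inverse_imp_right)
  show "ctrans g ** (g ** h) = h" "g ** (ctrans g ** h) = h"
    "ctrans g *v (g *v v) = v" "g *v (ctrans g *v v) = v"
    by (simp_all add: matrix_mul_assoc matrix_vector_mul_assoc *)
qed

lemma ctrans_unitary: "g \<in> carrier unitary_group \<Longrightarrow> ctrans g \<in> carrier unitary_group"
  for g :: "quat ^ 2 ^ 2"
  by (simp add: in_unitary_group_iff ctrans_left_inverse_imp_right)

lemma group_unitary_group: "group (unitary_group :: (quat ^ 2 ^ 2) monoid)"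
proof (rule groupI)
  fix g h k :: "quat ^ 2 ^ 2"
  assume g: "g \<in> carrier unitary_group"
  show "\<exists>h\<in>carrier unitary_group. h \<otimes>\<^bsub>unitary_group\<^esub> g = \<one>\<^bsub>unitary_group\<^esub>"
    using g ctrans_unitary unitary_cancel(1) by auto
qed (auto simp: unitary_group_def matrix_mul_assoc simp flip: matrix_vector_mul_assoc)

interpretation U: group "unitary_group :: (quat ^ 2 ^ 2) monoid"
  by (rule group_unitary_group)

lemma inv_unitary_group:
  "g \<in> carrier unitary_group \<Longrightarrow> inv\<^bsub>unitary_group\<^esub> g = ctrans g" for g :: "quat ^ 2 ^ 2"
  by (rule U.inv_equality) (simp_all add: ctrans_unitary unitary_cancel)

lemma subgroup_unitary_iff:
  "subgroup K unitary_group \<longleftrightarrow> K \<subseteq> carrier unitary_group \<and> mat 1 \<in> K \<and>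
     (\<forall>g\<in>K. \<forall>h\<in>K. g ** h \<in> K) \<and> (\<forall>g\<in>K. ctrans g \<in> K)" for K :: "(quat ^ 2 ^ 2) set"
  by (auto simp: subgroup_def inv_unitary_group subset_iff)

lemma mult_minus_mat2 [simp]: "- g ** h = - (g ** h)" "g ** - h = - (g ** h)" for g h :: "quat ^ 2 ^ 2"
  by (simp_all add: mat2_eq_iff)

lemma minus_unitary: "g \<in> carrier unitary_group \<Longrightarrow> - g \<in> carrier unitary_group" for g :: "quat ^ 2 ^ 2"
  by (simp add: in_unitary_group_iff)

declare One_nat_def [simp del]

section \<open>The regular simplex of Hermitian matrices\<close>

definition herm :: "real \<Rightarrow> quat \<Rightarrow> quat ^ 2 ^ 2" where
  "herm t q = mat2 (t *\<^sub>R 1) q (qcnj q) (- (t *\<^sub>R 1))"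

text \<open>The weights sqrt 6 / 2 and sqrt 2 / 2 give the six vertices integer coordinates. Here
  sqrt 6 is kept as a product so that \<open>sqrt_2_3\<close> reduces every monomial.\<close>

definition vertex_entry :: "real \<Rightarrow> real \<Rightarrow> real \<Rightarrow> real \<Rightarrow> quat" where
  "vertex_entry a b c d = Quat (sqrt 2 * sqrt 3 / 2 * a) (sqrt 2 / 2 * b) (sqrt 2 / 2 * c) (sqrt 2 * sqrt 3 / 2 * d)"

text \<open>\<open>vertex 6\<close> is, up to a real factor, the traceless part of \<open>w w\<^sup>*\<close>; the other vertices are its
  images under \<open>G\<close>.\<close>

definition vertex_coord :: "nat \<Rightarrow> real \<times> quat" where
  "vertex_coord k =
     (if k = 1 then (1, vertex_entry 0 (- 2) 2 0)
      else if k = 2 then (- 1, vertex_entry (- 1) (- 1) (- 1) (- 1))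
      else if k = 3 then (1, vertex_entry (- 1) 1 (- 1) 1)
      else if k = 4 then (- 1, vertex_entry 0 2 2 0)
      else if k = 5 then (- 1, vertex_entry 1 (- 1) (- 1) 1)
      else (1, vertex_entry 1 1 (- 1) (- 1)))"

definition vertex :: "nat \<Rightarrow> quat ^ 2 ^ 2" where
  "vertex k = herm (fst (vertex_coord k)) (snd (vertex_coord k))"

lemma atLeastAtMost_1_6: "{1..6 :: nat} = {1, 2, 3, 4, 5, 6}"
  by auto

text \<open>The Clifford relation: anticommutators are scalars, and they carry the Euclidean inner
  product of R x H, the five real coordinates of \<open>herm\<close>.\<close>

lemma herm_anticommutator:
  "herm t q ** herm t' q' + herm t' q' ** herm t q = mat ((2 * (t * t' + inner q q')) *\<^sub>R 1)"
  by (simp add: mat2_eq_iff herm_def quat_eq_iff inner_quat_def algebra_simps)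

lemma sqrt_2_3 [simp]:
  "sqrt 2 * (sqrt 2 * x) = 2 * x" "sqrt 3 * (sqrt 3 * x) = 3 * x"
  by (simp_all flip: mult.assoc)

lemma vertex_eq:
  "vertex 1 = mat2 1 (Quat 0 (- sqrt 2) (sqrt 2) 0) (Quat 0 (sqrt 2) (- sqrt 2) 0) (- 1)"
  "vertex 2 = mat2 (- 1)
     (Quat (- (sqrt 2 * sqrt 3 / 2)) (- (sqrt 2 / 2)) (- (sqrt 2 / 2)) (- (sqrt 2 * sqrt 3 / 2)))
     (Quat (- (sqrt 2 * sqrt 3 / 2)) (sqrt 2 / 2) (sqrt 2 / 2) (sqrt 2 * sqrt 3 / 2)) 1"
  "vertex 3 = mat2 1
     (Quat (- (sqrt 2 * sqrt 3 / 2)) (sqrt 2 / 2) (- (sqrt 2 / 2)) (sqrt 2 * sqrt 3 / 2))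
     (Quat (- (sqrt 2 * sqrt 3 / 2)) (- (sqrt 2 / 2)) (sqrt 2 / 2) (- (sqrt 2 * sqrt 3 / 2))) (- 1)"
  "vertex 4 = mat2 (- 1) (Quat 0 (sqrt 2) (sqrt 2) 0) (Quat 0 (- sqrt 2) (- sqrt 2) 0) 1"
  "vertex 5 = mat2 (- 1)
     (Quat (sqrt 2 * sqrt 3 / 2) (- (sqrt 2 / 2)) (- (sqrt 2 / 2)) (sqrt 2 * sqrt 3 / 2))
     (Quat (sqrt 2 * sqrt 3 / 2) (sqrt 2 / 2) (sqrt 2 / 2) (- (sqrt 2 * sqrt 3 / 2))) 1"
  "vertex 6 = mat2 1
     (Quat (sqrt 2 * sqrt 3 / 2) (sqrt 2 / 2) (- (sqrt 2 / 2)) (- (sqrt 2 * sqrt 3 / 2)))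
     (Quat (sqrt 2 * sqrt 3 / 2) (- (sqrt 2 / 2)) (sqrt 2 / 2) (sqrt 2 * sqrt 3 / 2)) (- 1)"
  by (simp_all add: vertex_def vertex_coord_def vertex_entry_def herm_def mat2_eq_iff quat_eq_iff)

text \<open>Half the scalar is the inner product: squared length 5 and mutual product -1, hence
  cosine -1/5, as for a regular simplex in dimension five.\<close>

lemma vertex_anticommutator:
  assumes "j \<in> {1..6}" "k \<in> {1..6}"
  shows "vertex j ** vertex k + vertex k ** vertex j = mat ((if j = k then 10 else - 2) *\<^sub>R 1)"
  using assms unfolding atLeastAtMost_1_6
  by (auto simp: vertex_def vertex_coord_def herm_anticommutator vertex_entry_def inner_quat_def)

lemma ctrans_vertex [simp]: "ctrans (vertex k) = vertex k"
  by (simp add: mat2_eq_iff vertex_def herm_def)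

lemma generators_sqrt:
  "b2 = mat2 (Quat 0 (sqrt 3 / 3) 0 0)          (Quat (sqrt 2 * sqrt 3 / 3) 0 0 0)
             (Quat (- (sqrt 2 * sqrt 3 / 3)) 0 0 0) (Quat 0 (- (sqrt 3 / 3)) 0 0)"
  "g2 = mat2 (Quat 0 (sqrt 3 / 3) 0 0)
             (Quat (sqrt 2 * sqrt 3 / 12) (sqrt 2 / 4) (sqrt 2 / 4) (- (sqrt 2 * sqrt 3 / 4)))
             (Quat (sqrt 2 * sqrt 3 / 6) 0 (sqrt 2 / 2) 0) (Quat (- 1 / 2) (sqrt 3 / 6) 0 0)"
  by (simp_all add: b2_def g2_def mat2_eq_iff quat_eq_iff real_sqrt_mult[of 2 3, simplified] field_simps)

lemma generators_unitary: "{b1, b2, b3, b4, g2} \<subseteq> carrier unitary_group"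
  unfolding generators_sqrt b1_def b3_def b4_def
  by (simp add: in_unitary_group_iff mat2_eq_iff quat_eq_iff algebra_simps)

text \<open>Conjugation is written without inverses, so that a check on a generator is an identity
  between matrix entries. It is a relation because a general matrix permutes no vertices;
  \<open>permutes\<close> pins \<pi> down outside 1..6 as well.\<close>

definition acts :: "quat ^ 2 ^ 2 \<Rightarrow> (nat \<Rightarrow> nat) \<Rightarrow> bool" where
  "acts g \<pi> \<longleftrightarrow> \<pi> permutes {1..6} \<and> (\<forall>k\<in>{1..6}. g ** vertex k = vertex (\<pi> k) ** g)"

lemma cycle_of_list_permutes: "set cs \<subseteq> A \<Longrightarrow> cycle_of_list cs permutes A"
  using cycle_permutes permutes_subset by blast

lemmas quat_sel = times_quat.sel plus_quat.sel quat.sel one_quat.sel zero_quat.sel uminus_quat.sel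

lemma actsI:
  assumes "\<pi> permutes {1..6}" "g ** vertex 1 = vertex (\<pi> 1) ** g" "g ** vertex 2 = vertex (\<pi> 2) ** g"
    "g ** vertex 3 = vertex (\<pi> 3) ** g" "g ** vertex 4 = vertex (\<pi> 4) ** g"
    "g ** vertex 5 = vertex (\<pi> 5) ** g" "g ** vertex 6 = vertex (\<pi> 6) ** g"
  shows "acts g \<pi>"
  using assms by (auto simp: acts_def atLeastAtMost_1_6)

text \<open>The permutations of \<open>b3\<close> and \<open>g2\<close> leave 6 alone: that vertex
  belongs to the lines of \<open>w_vec\<close> and \<open>w_perp\<close>, which is how
  \<open>H\<close> comes to preserve them.\<close>

lemma generators_permute:
  "acts b1 (cycle_of_list [6, 1, 3] \<circ> cycle_of_list [2, 4, 5])"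
  "acts b2 (cycle_of_list [6, 2] \<circ> cycle_of_list [3, 5])"
  "acts b3 (cycle_of_list [1, 3] \<circ> cycle_of_list [2, 4])"
  "acts b4 (cycle_of_list [6, 3] \<circ> cycle_of_list [2, 5])"
  "acts g2 (cycle_of_list [1, 2, 3, 4, 5])"
proof -
  have *: "cycle_of_list [6, 1, 3] \<circ> cycle_of_list [2, 4, 5] permutes {1..6 :: nat}"
    "cycle_of_list [6, 2] \<circ> cycle_of_list [3, 5] permutes {1..6 :: nat}"
    "cycle_of_list [1, 3] \<circ> cycle_of_list [2, 4] permutes {1..6 :: nat}"
    "cycle_of_list [6, 3] \<circ> cycle_of_list [2, 5] permutes {1..6 :: nat}"
    "cycle_of_list [1, 2, 3, 4, 5] permutes {1..6 :: nat}"
    by (intro permutes_compose cycle_of_list_permutes; simp)+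
  note defs = b1_def b3_def b4_def generators_sqrt
  show "acts b1 (cycle_of_list [6, 1, 3] \<circ> cycle_of_list [2, 4, 5])"
    "acts b2 (cycle_of_list [6, 2] \<circ> cycle_of_list [3, 5])"
    "acts b3 (cycle_of_list [1, 3] \<circ> cycle_of_list [2, 4])"
    "acts b4 (cycle_of_list [6, 3] \<circ> cycle_of_list [2, 5])"
    "acts g2 (cycle_of_list [1, 2, 3, 4, 5])"
    by (rule actsI, rule *; simp add: transpose_def vertex_eq defs;
      simp only: mat2_eq_iff mult_nth_2 mat2_nth; simp only: quat_eq_iff quat_sel; simp add: algebra_simps)+
qed

section \<open>The vertices span, and only \<plusminus>1 fixes all of them\<close>

lemma herm_add: "herm t q + herm t' q' = herm (t + t') (q + q')"
  by (simp add: herm_def mat2_eq_iff scaleR_left_distrib)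

lemma herm_scaleR: "r *\<^sub>R herm t q = herm (r * t) (r *\<^sub>R q)"
  by (simp add: herm_def mat2_eq_iff)

text \<open>A regular simplex is a tight frame; the frame constant is the total squared length 6 * 5
  divided by the dimension 5, whence the 6.\<close>

lemma vertex_tight_frame:
  "herm t q = (\<Sum>k\<in>{1..6}. ((t * fst (vertex_coord k) + inner q (snd (vertex_coord k))) / 6) *\<^sub>R vertex k)"
  by (simp add: atLeastAtMost_1_6 vertex_def herm_scaleR herm_add)
    (simp add: vertex_coord_def vertex_entry_def herm_def mat2_eq_iff quat_eq_iff inner_quat_def field_simps)

lemma commute_sum_scaleR:
  fixes g :: "quat ^ 2 ^ 2"
  assumes "\<And>k. k \<in> A \<Longrightarrow> g ** X k = X k ** g"
  shows "g ** (\<Sum>k\<in>A. c k *\<^sub>R X k) = (\<Sum>k\<in>A. c k *\<^sub>R X k) ** g"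
proof -
  have "g ** (h + h') = g ** h + g ** h'" "(h + h') ** g = h ** g + h' ** g"
    "g ** r *\<^sub>R h = r *\<^sub>R (g ** h)" "r *\<^sub>R h ** g = r *\<^sub>R (h ** g)" "g ** 0 = 0" "0 ** g = 0" for h h' and r :: real
    by (simp_all add: mat2_eq_iff algebra_simps)
  then show ?thesis
    using assms by (induction A rule: infinite_finite_induct) simp_all
qed

text \<open>By the frame expansion \<open>g\<close> commutes with every \<open>herm t q\<close>. The
  case diag(1, -1) makes \<open>g\<close> diagonal, q = 1 makes the diagonal entries equal, and q =
  i, j make them real; unitarity leaves \<plusminus>1.\<close>

lemma acts_id_imp:
  assumes "g \<in> carrier unitary_group" "acts g id" shows "g = mat 1 \<or> g = - mat 1"
proof -
  have comm: "g ** herm t q = herm t q ** g" for t q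
    unfolding vertex_tight_frame[of t q] using assms(2) by (intro commute_sum_scaleR) (simp add: acts_def)
  have off: "g $ 1 $ 2 = 0" "g $ 2 $ 1 = 0"
    using comm[of 1 0] by (auto simp: mat2_eq_iff herm_def quat_eq_iff)
  have diag: "g $ 1 $ 1 * q = q * g $ 2 $ 2" for q
    using comm[of 0 q] by (simp add: mat2_eq_iff herm_def)
  have eq: "g $ 2 $ 2 = g $ 1 $ 1"
    using diag[of 1] by simp
  have "QI (g $ 1 $ 1) = 0" "QJ (g $ 1 $ 1) = 0" "QK (g $ 1 $ 1) = 0"
    using diag[of "Quat 0 1 0 0"] diag[of "Quat 0 0 1 0"] by (simp_all add: eq quat_eq_iff)
  moreover from this have "(QRe (g $ 1 $ 1))\<^sup>2 = 1"
    using assms(1) by (simp add: in_unitary_group_iff mat2_eq_iff off quat_eq_iff power2_eq_square)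
  ultimately show ?thesis
    by (auto simp: mat2_eq_iff off eq quat_eq_iff power2_eq_1_iff)
qed

section \<open>Lines and subspaces of the quaternionic plane\<close>

lemma right_subspaceD:
  assumes "right_subspace S"
  shows "0 \<in> S" "v \<in> S \<Longrightarrow> w \<in> S \<Longrightarrow> v + w \<in> S" "v \<in> S \<Longrightarrow> v \<cdot> a \<in> S"
  using assms by (auto simp: right_subspace_def)

lemma right_span_minimal: "B \<subseteq> S \<Longrightarrow> right_subspace S \<Longrightarrow> right_span B \<subseteq> S"
  unfolding right_span_def by (rule hull_minimal)

lemma right_span_subspace: "right_subspace S \<Longrightarrow> right_span S = S"
  unfolding right_span_def by (rule hull_same)

lemma right_subspace_range_rscale: "right_subspace (range (\<lambda>a. v \<cdot> a))"
  unfolding right_subspace_def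
proof (intro conjI ballI allI)
  show "0 \<in> range (\<lambda>a. v \<cdot> a)"
    by (rule range_eqI[of _ _ 0]) simp
next
  fix x y and b assume "x \<in> range (\<lambda>a. v \<cdot> a)" "y \<in> range (\<lambda>a. v \<cdot> a)"
  then obtain a a' where "x = v \<cdot> a" "y = v \<cdot> a'"
    by blast
  then show "x + y \<in> range (\<lambda>a. v \<cdot> a)"
    by (intro range_eqI[of _ _ "a + a'"]) simp
qed auto

lemma right_span_singleton: "right_span {v} = range (\<lambda>a. v \<cdot> a)"
proof -
  have "v \<in> range (\<lambda>a. v \<cdot> a)"
    by (metis rangeI rscale_simps(1))
  then show ?thesis
    unfolding right_span_def using right_subspace_range_rscale
    by (intro hull_unique) (auto simp: right_subspaceD)
qed

lemma right_subspace_span_singleton: "right_subspace (right_span {v})"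
  by (simp add: right_span_singleton right_subspace_range_rscale)

lemma in_right_span_singleton: "v \<cdot> a \<in> right_span {v}" "v \<in> right_span {v}"
  unfolding right_span_singleton by (auto intro: range_eqI[of _ _ 1])

lemma right_span_singleton_nonzero: "v \<noteq> 0 \<Longrightarrow> right_span {v} \<noteq> {0}"
  using in_right_span_singleton(2)[of v] by auto

lemma right_span_singleton_eq:
  assumes "w \<in> right_span {v}" "w \<noteq> 0" shows "right_span {w} = right_span {v}"
proof -
  obtain a where a: "w = v \<cdot> a"
    using assms(1) by (auto simp: right_span_singleton)
  then have "a \<noteq> 0"
    using assms(2) by auto
  then have "v \<cdot> b = w \<cdot> (inverse a * b)" for b
    by (simp add: a flip: mult.assoc)
  then show ?thesis
    unfolding right_span_singleton by (force simp: a)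
qed

lemma right_independent_singleton: "v \<noteq> 0 \<Longrightarrow> right_independent {v}"
  by (auto simp: right_independent_def subset_singleton_iff)

lemma is_line_right_span: "v \<noteq> 0 \<Longrightarrow> is_line (right_span {v})"
  unfolding is_line_def has_right_dim_def
  using right_independent_singleton right_subspace_span_singleton
  by (metis card.empty card.insert card_eq_0_iff empty_iff finite.intros One_nat_def)

text \<open>Gaussian elimination with right scalars: a nonzero coordinate \<open>i\<close> of
  \<open>v\<close> is the pivot, and clearing it from \<open>u\<close> and \<open>x\<close> leaves
  vectors supported on the other coordinate \<open>k\<close>.\<close>

lemma plane_spanned_by_two:
  fixes u v x :: "quat ^ 2"
  assumes "v \<noteq> 0" "u \<notin> right_span {v}"
  obtains a b where "x = v \<cdot> a + u \<cdot> b"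
proof -
  have *: "\<exists>a b. x = v \<cdot> a + u \<cdot> b" if i: "v $ i \<noteq> 0" "\<And>j. j = i \<or> j = k" for i k
  proof -
    define u' where "u' = u - v \<cdot> (inverse (v $ i) * u $ i)"
    define x' where "x' = x - v \<cdot> (inverse (v $ i) * x $ i)"
    have zero: "u' $ i = 0" "x' $ i = 0"
      using i(1) by (simp_all add: u'_def x'_def flip: mult.assoc)
    have "u' \<noteq> 0"
      unfolding u'_def using assms(2) in_right_span_singleton(1) by (metis eq_iff_diff_eq_0)
    moreover have "u' $ j = 0" if "u' $ k = 0" for j
      using zero that i(2)[of j] by auto
    ultimately have uk: "u' $ k \<noteq> 0"
      by (auto simp: vec_eq_iff)
    have "x' $ j = (u' \<cdot> (inverse (u' $ k) * x' $ k)) $ j" for j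
      using zero uk i(2)[of j] by (auto simp flip: mult.assoc)
    then obtain c where "x' = u' \<cdot> c"
      by (metis vec_eq_iff)
    then have "x = v \<cdot> (inverse (v $ i) * x $ i - inverse (v $ i) * u $ i * c) + u \<cdot> c"
      by (simp add: x'_def u'_def vec_eq_iff algebra_simps)
    then show ?thesis
      by blast
  qed
  have "v $ 1 \<noteq> 0 \<or> v $ 2 \<noteq> 0"
    using assms(1) by (simp add: vec2_eq_iff)
  then have "\<exists>a b. x = v \<cdot> a + u \<cdot> b"
  proof
    assume "v $ 1 \<noteq> 0" then show ?thesis
      by (rule *) (rule exhaust_2)
  next
    assume "v $ 2 \<noteq> 0" then show ?thesis
      by (rule *[where k = 1]) (use exhaust_2 in blast)
  qed
  then show ?thesis
    using that by blast
qed

lemma right_subspace_plane_cases: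
  fixes S :: "(quat ^ 2) set"
  assumes "right_subspace S" "v \<in> S" "v \<noteq> 0"
  shows "S = right_span {v} \<or> S = UNIV"
proof (cases "S \<subseteq> right_span {v}")
  case True
  then show ?thesis
    using right_span_minimal[of "{v}" S] assms by blast
next
  case False
  then obtain u where "u \<in> S" "u \<notin> right_span {v}"
    by blast
  then have "x \<in> S" for x
    using plane_spanned_by_two[OF assms(3), of u x] assms(1,2) by (metis right_subspaceD(2,3))
  then show ?thesis
    by blast
qed

lemma right_span_singleton_neq_UNIV: "right_span {v :: quat ^ 2} \<noteq> UNIV"
proof
  assume *: "right_span {v} = UNIV"
  then obtain a b where a: "v \<cdot> a = vector [1, 0]" and b: "v \<cdot> b = vector [0, 1]"
    unfolding right_span_singleton by (metis UNIV_I imageE)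
  then have "v $ 1 * a = 1" "v $ 1 * b = 0" "v $ 2 * b = 1"
    by (metis rscale_nth vector_2)+
  then show False
    by (metis mult_eq_0_iff mult_zero_left mult_zero_right zero_neq_one)
qed

lemma right_subspace_line:
  fixes S :: "(quat ^ 2) set"
  assumes "right_subspace S" "v \<in> S" "v \<noteq> 0" "S \<noteq> UNIV"
  shows "S = right_span {v}"
  using right_subspace_plane_cases assms by blast

section \<open>Direct sums in the plane\<close>

lemma direct_sum_of_orthogonal_lines:
  fixes v w :: "quat ^ 2"
  assumes "v \<noteq> 0" "w \<noteq> 0" "qinner v w = 0"
  shows "is_direct_sum {right_span {v}, right_span {w}} UNIV"
proof -
  let ?V = "right_span {v}" and ?W = "right_span {w}"
  have orth: "qinner x y = 0" if "x \<in> ?V" "y \<in> ?W" for x y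
    using that assms(3) by (auto simp: right_span_singleton qinner_simps)
  have neq: "?V \<noteq> ?W"
    using orth in_right_span_singleton(2) assms(1) by (metis qinner_self_eq_0_iff)
  have "w \<notin> ?V"
    using orth[of w w] in_right_span_singleton(2) assms(2) by auto
  then have ex: "\<exists>f. f \<in> (\<Pi>\<^sub>E V\<in>{?V, ?W}. V) \<and> x = (\<Sum>V\<in>{?V, ?W}. f V)" for x
  proof -
    obtain a b where ab: "x = v \<cdot> a + w \<cdot> b"
      using plane_spanned_by_two[OF assms(1) \<open>w \<notin> ?V\<close>] .
    \<comment> \<open>The lines index themselves, so their distinctness matters here; the value
      \<open>undefined\<close> elsewhere makes the family extensional.\<close>
    let ?f = "\<lambda>V. if V = ?V then v \<cdot> a else if V = ?W then w \<cdot> b else undefined"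
    have "?f \<in> (\<Pi>\<^sub>E V\<in>{?V, ?W}. V)"
      using neq by (auto simp: PiE_iff extensional_def in_right_span_singleton)
    moreover have "x = (\<Sum>V\<in>{?V, ?W}. ?f V)"
      using neq ab by simp
    ultimately show ?thesis
      by blast
  qed
  have unique: "f = f'"
    if f: "f \<in> (\<Pi>\<^sub>E V\<in>{?V, ?W}. V)" "f' \<in> (\<Pi>\<^sub>E V\<in>{?V, ?W}. V)"
      "(\<Sum>V\<in>{?V, ?W}. f V) = (\<Sum>V\<in>{?V, ?W}. f' V)" for f f'
  proof -
    obtain a b a' b' where ab: "f ?V = v \<cdot> a" "f ?W = w \<cdot> b" "f' ?V = v \<cdot> a'" "f' ?W = w \<cdot> b'"
      using f(1,2) by (auto simp: PiE_iff right_span_singleton)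
    then have eq: "v \<cdot> a + w \<cdot> b = v \<cdot> a' + w \<cdot> b'"
      using f(3) neq by simp
    \<comment> \<open>Pairing the equation with \<open>v\<close> and with \<open>w\<close> isolates
      one coefficient each.\<close>
    have "qinner w v = 0"
      using assms(3) by (metis qcnj_qinner qcnj_eq_0_iff)
    then have "qinner v v * a = qinner v v * a'" "qinner w w * b = qinner w w * b'"
      using arg_cong[OF eq, of "qinner v"] arg_cong[OF eq, of "qinner w"] assms(3)
      by (simp_all add: qinner_simps)
    then have "a = a'" "b = b'"
      using assms(1,2) by auto
    then have "f V = f' V" if "V \<in> {?V, ?W}" for V
      using that ab by auto
    then show "f = f'"
      by (rule PiE_ext[OF f(1,2)])
  qed
  show ?thesis
    unfolding is_direct_sum_def
  proof (intro conjI ballI)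
    show "UNIV = {\<Sum>V\<in>{?V, ?W}. f V |f. f \<in> (\<Pi>\<^sub>E V\<in>{?V, ?W}. V)}"
      using ex by auto
    show "\<exists>!f. f \<in> (\<Pi>\<^sub>E V\<in>{?V, ?W}. V) \<and> x = (\<Sum>V\<in>{?V, ?W}. f V)" for x
    proof (rule ex_ex1I[OF ex])
      fix f f'
      assume "f \<in> (\<Pi>\<^sub>E V\<in>{?V, ?W}. V) \<and> x = (\<Sum>V\<in>{?V, ?W}. f V)"
        "f' \<in> (\<Pi>\<^sub>E V\<in>{?V, ?W}. V) \<and> x = (\<Sum>V\<in>{?V, ?W}. f' V)"
      then show "f = f'"
        by (intro unique) simp_all
    qed
  qed (auto simp: right_subspace_span_singleton)
qed

text \<open>Two summands through nonzero vectors already exhaust the plane, so a third one is impossible.\<close>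

lemma direct_sum_plane_card_le_2:
  fixes V1 V2 V3 :: "(quat ^ 2) set"
  assumes sum: "is_direct_sum \<V> UNIV" and V: "V1 \<in> \<V>" "V2 \<in> \<V>" "V3 \<in> \<V>"
    and neq: "V1 \<noteq> V2" "V1 \<noteq> V3" "V2 \<noteq> V3" and nz: "V1 \<noteq> {0}" "V2 \<noteq> {0}" "V3 \<noteq> {0}"
  shows False
proof -
  have fin: "finite \<V>" and sub: "\<And>V. V \<in> \<V> \<Longrightarrow> right_subspace V"
    and uniq: "\<And>v. \<exists>!f. f \<in> (\<Pi>\<^sub>E V\<in>\<V>. V) \<and> v = (\<Sum>V\<in>\<V>. f V)"
    using sum by (auto simp: is_direct_sum_def)
  have "\<exists>v\<in>V. v \<noteq> 0" if "V \<in> \<V>" "V \<noteq> {0}" for V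
    using right_subspaceD(1)[OF sub[OF that(1)]] that(2) by blast
  then obtain v1 v2 v3 where v: "v1 \<in> V1" "v2 \<in> V2" "v3 \<in> V3" "v1 \<noteq> 0" "v2 \<noteq> 0" "v3 \<noteq> 0"
    using nz V by metis
  let ?f = "\<lambda>x1 x2 x3 V. if V \<in> \<V> then (if V = V1 then x1 else if V = V2 then x2 else if V = V3 then x3 else 0) else undefined"
  have in_Pi: "?f x1 x2 x3 \<in> (\<Pi>\<^sub>E V\<in>\<V>. V)" if "x1 \<in> V1" "x2 \<in> V2" "x3 \<in> V3" for x1 x2 x3
    using that sub V by (auto simp: PiE_iff extensional_def right_subspaceD(1))
  have sum_f: "(\<Sum>V\<in>\<V>. ?f x1 x2 x3 V) = x1 + x2 + x3" for x1 x2 x3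
  proof -
    have "(\<Sum>V\<in>\<V>. ?f x1 x2 x3 V) = (\<Sum>V\<in>{V1, V2, V3}. ?f x1 x2 x3 V)"
      using V by (intro sum.mono_neutral_right fin) auto
    then show ?thesis
      using V neq by (simp add: add.assoc)
  qed
  have eq: "?f x1 x2 x3 = ?f y1 y2 y3"
    if "x1 \<in> V1" "x2 \<in> V2" "x3 \<in> V3" "y1 \<in> V1" "y2 \<in> V2" "y3 \<in> V3" "x1 + x2 + x3 = y1 + y2 + y3"
    for x1 x2 x3 y1 y2 y3
  proof -
    obtain f0 where f0: "\<forall>f. f \<in> (\<Pi>\<^sub>E V\<in>\<V>. V) \<and> x1 + x2 + x3 = (\<Sum>V\<in>\<V>. f V) \<longrightarrow> f = f0"
      using uniq[of "x1 + x2 + x3"] unfolding Ex1_def by (elim exE conjE) (rule that)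
    have "?f x1 x2 x3 = f0" "?f y1 y2 y3 = f0"
      by (rule f0[rule_format]; simp only: in_Pi sum_f that)+
    then show ?thesis
      by (simp only:)
  qed
  have unique3: "x3 = y3"
    if "x1 \<in> V1" "x2 \<in> V2" "x3 \<in> V3" "y1 \<in> V1" "y2 \<in> V2" "y3 \<in> V3" "x1 + x2 + x3 = y1 + y2 + y3"
    for x1 x2 x3 y1 y2 y3
    using fun_cong[OF eq[OF that], of V3] V neq by simp
  have unique2: "x2 = y2"
    if "x1 \<in> V1" "x2 \<in> V2" "x3 \<in> V3" "y1 \<in> V1" "y2 \<in> V2" "y3 \<in> V3" "x1 + x2 + x3 = y1 + y2 + y3"
    for x1 x2 x3 y1 y2 y3
    using fun_cong[OF eq[OF that], of V2] V neq by simp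
  note zero = right_subspaceD(1)[OF sub]
  have "v2 \<notin> right_span {v1}"
  proof
    assume "v2 \<in> right_span {v1}"
    then have "v2 \<in> V1"
      using right_span_minimal[of "{v1}" V1] v sub V by auto
    then show False
      using unique2[of 0 v2 0 v2 0 0] v zero V by auto
  qed
  then obtain a b where "v3 = v1 \<cdot> a + v2 \<cdot> b"
    using plane_spanned_by_two v(4) by blast
  then show False
    using unique3[of 0 0 v3 "v1 \<cdot> a" "v2 \<cdot> b" 0] v zero V right_subspaceD(3)[OF sub] by auto
qed

section \<open>Generation of alternating groups by three-cycles\<close>

lemma cycle_of_list_rotate3:
  "distinct [a, b, c] \<Longrightarrow> cycle_of_list [a, b, c] = cycle_of_list [b, c, a]"
  using cycle_of_list_rotate_independent[of "[a, b, c]" 1] by (simp add: One_nat_def)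

lemma inv_cycle_of_list3:
  assumes "distinct [a, b, c]" shows "inv' (cycle_of_list [a, b, c]) = cycle_of_list [c, b, a]"
proof (rule inv_unique_comp)
  show "cycle_of_list [a, b, c] \<circ> cycle_of_list [c, b, a] = id"
    "cycle_of_list [c, b, a] \<circ> cycle_of_list [a, b, c] = id"
    using assms by (auto simp: fun_eq_iff transpose_commute[of c b] transpose_commute[of b a])
qed

text \<open>Turns every identity between words in permutations below into six evaluations.\<close>

lemma permutes_6_eqI:
  assumes "\<pi> permutes {1..6 :: nat}" "\<rho> permutes {1..6}"
    "\<pi> 1 = \<rho> 1" "\<pi> 2 = \<rho> 2" "\<pi> 3 = \<rho> 3" "\<pi> 4 = \<rho> 4" "\<pi> 5 = \<rho> 5" "\<pi> 6 = \<rho> 6"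
  shows "\<pi> = \<rho>"
proof
  fix k show "\<pi> k = \<rho> k"
    using assms permutes_not_in[OF assms(1)] permutes_not_in[OF assms(2)]
    by (cases "k \<in> {1..6}") (auto simp: atLeastAtMost_1_6)
qed

text \<open>A group of permutations kept as a bare set of functions, so that the permutations
  induced by a matrix group fit directly.\<close>

locale permutation_set =
  fixes P :: "(nat \<Rightarrow> nat) set"
  assumes bij: "p \<in> P \<Longrightarrow> bij p"
    and id_mem: "id \<in> P"
    and comp_mem: "p \<in> P \<Longrightarrow> q \<in> P \<Longrightarrow> p \<circ> q \<in> P"
    and inv_mem: "p \<in> P \<Longrightarrow> inv' p \<in> P"
begin

lemma conj_mem:
  assumes "p \<in> P" "cycle_of_list cs \<in> P" "distinct cs"
  shows "cycle_of_list (map p cs) \<in> P"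
  using comp_mem[OF comp_mem[OF assms(1,2)] inv_mem[OF assms(1)]]
    conjugation_of_cycle[OF assms(3) bij[OF assms(1)]] by simp

lemma rotate3_mem: "cycle_of_list [a, b, c] \<in> P \<Longrightarrow> distinct [a, b, c] \<Longrightarrow> cycle_of_list [b, c, a] \<in> P"
  using cycle_of_list_rotate3 by metis

lemma reverse3_mem: "cycle_of_list [a, b, c] \<in> P \<Longrightarrow> distinct [a, b, c] \<Longrightarrow> cycle_of_list [c, b, a] \<in> P"
  using inv_mem inv_cycle_of_list3 by metis

lemma alt_group_subset:
  assumes three_cycles: "three_cycles n \<subseteq> P" shows "carrier (alt_group n) \<subseteq> P"
proof
  fix p assume "p \<in> carrier (alt_group n)"
  then have "p \<in> generate (alt_group n) (three_cycles n)"
    using alt_group_carrier_as_three_cycles by blast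
  then show "p \<in> P"
  proof induction
    case (inv h)
    then have "h \<in> carrier (alt_group n)"
      using three_cycles_incl by blast
    then show ?case
      using inv alt_group_inv_equality[of h n] three_cycles inv_mem[of h] by auto
  next
    case (eng h1 h2)
    then show ?case
      using comp_mem[of h1 h2] by (simp only: alt_group_mult)
  next
    case one
    then show ?case
      using id_mem by (simp only: alt_group_one)
  next
    case (incl h)
    then show ?case
      using three_cycles by blast
  qed
qed

text \<open>Conjugation relabels a cycle. The cycle (1 2 a) carries (1 2 b) to (2 a b), and its
  inverse (a 2 1) carries (1 2 b) to (a 1 b) and (1 b c) to (a b c); rotations and inverses supply
  the remaining orderings.\<close>

lemma alt_group_subset_of_cycles_1_2:
  assumes "\<And>k. k \<in> {3..n} \<Longrightarrow> cycle_of_list [1, 2, k] \<in> P"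
  shows "carrier (alt_group n) \<subseteq> P"
proof (rule alt_group_subset)
  define T where "T a b c \<longleftrightarrow> cycle_of_list [a, b, c] \<in> P" for a b c
  have rot: "T b c a" if "T a b c" "distinct [a, b, c]" for a b c
    using that unfolding T_def by (rule rotate3_mem)
  have rev: "T c b a" if "T a b c" "distinct [a, b, c]" for a b c
    using that unfolding T_def by (rule reverse3_mem)
  have conj: "T (p a) (p b) (p c)" if "T a b c" "distinct [a, b, c]" "p \<in> P" for a b c p
    using conj_mem[of p "[a, b, c]"] that by (simp add: T_def)
  have T12: "T 1 2 k" if "k \<in> {3..n}" for k
    using assms that by (simp add: T_def)
  have T2: "T 2 a b" if "a \<in> {3..n}" "b \<in> {3..n}" "a \<noteq> b" for a b
    using conj[OF T12[OF that(2)], of "cycle_of_list [1, 2, a]"] T12[OF that(1)] that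
    by (simp add: T_def Transposition.transpose_def)
  have T1: "T 1 a b" if "a \<in> {3..n}" "b \<in> {3..n}" "a \<noteq> b" for a b
  proof -
    have "T a 1 b"
      using conj[OF T12[OF that(2)], of "cycle_of_list [a, 2, 1]"] rev[OF T12[OF that(1)]] that
      by (simp add: T_def Transposition.transpose_def)
    then show ?thesis
      using rev[of a 1 b] rot[of b 1 a] that by simp
  qed
  have T0: "T a b c" if "a \<in> {3..n}" "b \<in> {3..n}" "c \<in> {3..n}" "distinct [a, b, c]" for a b c
    using conj[OF T1[OF that(2,3)], of "cycle_of_list [a, 2, 1]"] rev[OF T12[OF that(1)]] that
    by (simp add: T_def Transposition.transpose_def)
  have all: "T a b c" if abc: "{a, b, c} \<subseteq> {1..n}" "distinct [a, b, c]" for a b c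
  proof -
    have "x = 1 \<or> x = 2 \<or> x \<in> {3..n}" if "x \<in> {1..n}" for x
      using that by auto
    then have "a = 1 \<or> a = 2 \<or> a \<in> {3..n}" "b = 1 \<or> b = 2 \<or> b \<in> {3..n}" "c = 1 \<or> c = 2 \<or> c \<in> {3..n}"
      using abc(1) by blast+
    moreover have T21: "T 2 1 k" if "k \<in> {3..n}" for k
      using rot[OF rot[OF rev[OF T12[OF that]]]] rot[OF rev[OF T12[OF that]]] that by simp
    ultimately show ?thesis
      using abc(2) T12 T21 T1 T2 T0 rot[of 1 2 c] rot[of a b c] rot[of c a b] rot[of b c a] by auto
  qed
  show "three_cycles n \<subseteq> P"
  proof
    fix p assume "p \<in> three_cycles n"
    then obtain cs where cs: "p = cycle_of_list cs" "distinct cs" "length cs = 3" "set cs \<subseteq> {1..n}"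
      by blast
    then show "p \<in> P"
      using all[of "cs ! 0" "cs ! 1" "cs ! 2"] stupid_lemma[of cs] by (metis T_def list.simps(15) set_empty)
  qed
qed

text \<open>The involution times the square of the five-cycle is a three-cycle. Conjugating by the
  five-cycle shifts its labels cyclically, which leads to (1 2 3) and (1 2 5); (3 4 5) carries the
  former to (1 2 4).\<close>

lemma alt_group_5_subset:
  assumes c: "cycle_of_list [1, 2, 3, 4, 5] \<in> P" and t: "cycle_of_list [1, 3] \<circ> cycle_of_list [2, 4] \<in> P"
  shows "carrier (alt_group 5) \<subseteq> P"
proof (rule alt_group_subset_of_cycles_1_2)
  let ?c = "cycle_of_list [1, 2, 3, 4, 5 :: nat]"
  have "(cycle_of_list [1, 3] \<circ> cycle_of_list [2, 4]) \<circ> (?c \<circ> ?c) = cycle_of_list [3, 5, 4]"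
    by (rule permutes_6_eqI; (intro permutes_compose cycle_of_list_permutes)?; simp add: Transposition.transpose_def)
  then have "cycle_of_list [3, 5, 4] \<in> P"
    using comp_mem[OF t comp_mem[OF c c]] by simp
  then have c345: "cycle_of_list [3, 4, 5] \<in> P"
    using reverse3_mem[of 3 5 4] rotate3_mem[of 4 5 3] rotate3_mem[of 5 3 4] by simp
  have "cycle_of_list [4, 5, 1] \<in> P"
    using conj_mem[OF c c345] by (simp add: Transposition.transpose_def)
  then have c512: "cycle_of_list [5, 1, 2] \<in> P"
    using conj_mem[OF c, of "[4, 5, 1]"] by (simp add: Transposition.transpose_def)
  then have c123: "cycle_of_list [1, 2, 3] \<in> P"
    using conj_mem[OF c, of "[5, 1, 2]"] by (simp add: Transposition.transpose_def)
  have c124: "cycle_of_list [1, 2, 4] \<in> P"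
    using conj_mem[OF c345 c123] by (simp add: Transposition.transpose_def)
  fix k :: nat assume "k \<in> {3..5}"
  then have "k = 3 \<or> k = 4 \<or> k = 5"
    by auto
  then show "cycle_of_list [1, 2, k] \<in> P"
    using c123 c124 rotate3_mem[OF c512] by auto
qed

end

lemma three_cycle_in_alt_group:
  "distinct [a, b, c] \<Longrightarrow> {a, b, c} \<subseteq> {1..n} \<Longrightarrow> cycle_of_list [a, b, c] \<in> carrier (alt_group n)"
  using three_cycles_incl[of n] by (rule subsetD) (auto intro!: exI[of _ "[a, b, c]"])

lemma evenperm_double_transposition:
  "a \<noteq> b \<Longrightarrow> c \<noteq> d \<Longrightarrow> evenperm (cycle_of_list [a, b] \<circ> cycle_of_list [c, d])"
  by (simp add: evenperm_comp permutation_swap_id evenperm_swap)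

lemma double_transposition_in_alt_group:
  assumes "a \<noteq> b" "c \<noteq> d" "{a, b, c, d} \<subseteq> {1..n}"
  shows "cycle_of_list [a, b] \<circ> cycle_of_list [c, d] \<in> carrier (alt_group n)"
  unfolding alt_group_carrier using assms evenperm_double_transposition[of a b c d]
  by (intro conjI permutes_compose cycle_of_list_permutes) auto

lemma alt_group_mono: "m \<le> n \<Longrightarrow> carrier (alt_group m) \<subseteq> carrier (alt_group n)"
  using permutes_subset[of _ "{1..m}" "{1..n}"] by (auto simp: alt_group_carrier)

lemma comp_in_alt_group:
  "\<pi> \<in> carrier (alt_group n) \<Longrightarrow> \<rho> \<in> carrier (alt_group n) \<Longrightarrow> \<pi> \<circ> \<rho> \<in> carrier (alt_group n)"
  using group.is_monoid[OF alt_group_is_group] monoid.m_closed alt_group_mult by metis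

text \<open>Exhibits the permutation of \<open>g2\<close> as a product of three-cycles, hence as
  even.\<close>

lemma five_cycle_eq:
  "cycle_of_list [1, 2, 3, 4, 5] = cycle_of_list [1, 2, 3] \<circ> cycle_of_list [3, 4, 5 :: nat]"
  by (rule permutes_6_eqI; (intro permutes_compose cycle_of_list_permutes)?; simp add: Transposition.transpose_def)

lemma generators_even:
  "cycle_of_list [6, 1, 3] \<circ> cycle_of_list [2, 4, 5] \<in> carrier (alt_group 6)"
  "cycle_of_list [6, 2] \<circ> cycle_of_list [3, 5] \<in> carrier (alt_group 6)"
  "cycle_of_list [1, 3] \<circ> cycle_of_list [2, 4] \<in> carrier (alt_group 5)"
  "cycle_of_list [6, 3] \<circ> cycle_of_list [2, 5] \<in> carrier (alt_group 6)"
  "cycle_of_list [1, 2, 3, 4, 5] \<in> carrier (alt_group 5)"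
  unfolding five_cycle_eq
  by (intro comp_in_alt_group three_cycle_in_alt_group double_transposition_in_alt_group; simp)+

section \<open>The action on the vertices of the simplex\<close>

lemma inj_on_vertex: "inj_on vertex {1..6}"
proof (rule inj_onI, rule ccontr)
  fix j k assume jk: "j \<in> {1..6 :: nat}" "k \<in> {1..6}" "vertex j = vertex k" "j \<noteq> k"
  then have "mat ((- 2 :: real) *\<^sub>R 1) = (mat (10 *\<^sub>R 1) :: quat ^ 2 ^ 2)"
    using vertex_anticommutator[of j k] vertex_anticommutator[of j j] by simp
  then show False
    by (simp add: mat2_eq_iff quat_eq_iff)
qed

lemma acts_permutes: "acts g \<pi> \<Longrightarrow> \<pi> permutes {1..6}"
  by (simp add: acts_def)

lemma acts_in_iff: "acts g \<pi> \<Longrightarrow> \<pi> k \<in> {1..6} \<longleftrightarrow> k \<in> {1..6}"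
  by (rule permutes_in_image[OF acts_permutes])

lemma acts_one: "acts (mat 1) id"
  by (simp add: acts_def permutes_id mat2_eq_iff)

lemma acts_mult:
  assumes "acts g \<pi>" "acts h \<rho>" shows "acts (g ** h) (\<pi> \<circ> \<rho>)"
  unfolding acts_def
proof (intro conjI ballI)
  show "\<pi> \<circ> \<rho> permutes {1..6}"
    using assms by (simp add: acts_permutes permutes_compose)
  fix k :: nat assume "k \<in> {1..6}"
  moreover from this have "\<rho> k \<in> {1..6}"
    using acts_in_iff[OF assms(2)] by blast
  ultimately have "h ** vertex k = vertex (\<rho> k) ** h" "g ** vertex (\<rho> k) = vertex (\<pi> (\<rho> k)) ** g"
    using assms by (simp_all add: acts_def)
  then show "g ** h ** vertex k = vertex ((\<pi> \<circ> \<rho>) k) ** (g ** h)"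
    by (simp flip: matrix_mul_assoc) (simp add: matrix_mul_assoc)
qed

lemma acts_ctrans:
  assumes "g \<in> carrier unitary_group" "acts g \<pi>" shows "acts (ctrans g) (inv' \<pi>)"
  unfolding acts_def
proof (intro conjI ballI)
  show perm: "inv' \<pi> permutes {1..6}"
    using assms(2) by (simp add: acts_permutes permutes_inv)
  fix k :: nat assume "k \<in> {1..6}"
  then have "inv' \<pi> k \<in> {1..6}" "\<pi> (inv' \<pi> k) = k"
    using permutes_in_image[OF perm, of k] permutes_inverses(1)[OF acts_permutes[OF assms(2)]] by simp_all
  then have "g ** vertex (inv' \<pi> k) = vertex k ** g"
    using assms(2) by (metis acts_def)
  then have "ctrans g ** (g ** vertex (inv' \<pi> k)) ** ctrans g = ctrans g ** (vertex k ** g) ** ctrans g"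
    by simp
  then have "vertex (inv' \<pi> k) ** ctrans g = ctrans g ** (vertex k ** (g ** ctrans g))"
    by (simp only: unitary_cancel(3)[OF assms(1)]) (simp only: matrix_mul_assoc)
  then show "ctrans g ** vertex k = vertex (inv' \<pi> k) ** ctrans g"
    by (simp add: unitary_cancel(2)[OF assms(1)])
qed

lemma acts_unique:
  assumes "g \<in> carrier unitary_group" "acts g \<pi>" "acts g \<rho>" shows "\<pi> = \<rho>"
proof
  fix k
  show "\<pi> k = \<rho> k"
  proof (cases "k \<in> {1..6}")
    case True
    then have "vertex (\<pi> k) ** g ** ctrans g = vertex (\<rho> k) ** g ** ctrans g"
      using assms(2,3) by (metis acts_def)
    then have "vertex (\<pi> k) = vertex (\<rho> k)"
      using unitary_cancel(2)[OF assms(1)] by (simp flip: matrix_mul_assoc)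
    then show ?thesis
      by (rule inj_onD[OF inj_on_vertex]) (simp_all only: acts_in_iff[OF assms(2)] acts_in_iff[OF assms(3)] True)
  next
    case False
    then show ?thesis
      using permutes_not_in[OF acts_permutes[OF assms(2)]] permutes_not_in[OF acts_permutes[OF assms(3)]]
      by metis
  qed
qed

lemma acts_same_imp:
  assumes "g \<in> carrier unitary_group" "h \<in> carrier unitary_group" "acts g \<pi>" "acts h \<pi>"
  shows "g = h \<or> g = - h"
proof -
  have "acts (ctrans h ** g) id"
    using acts_mult[OF acts_ctrans[OF assms(2,4)] assms(3)] permutes_inv_o(2)[OF acts_permutes[OF assms(3)]]
    by simp
  then have "ctrans h ** g = mat 1 \<or> ctrans h ** g = - mat 1"
    using acts_id_imp U.m_closed[OF ctrans_unitary[OF assms(2)] assms(1)] by simp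
  then have "h ** (ctrans h ** g) = h \<or> h ** (ctrans h ** g) = - h"
    by auto
  then show ?thesis
    using unitary_cancel(4)[OF assms(2)] by simp
qed

lemma acts_uminus: "acts g \<pi> \<Longrightarrow> acts (- g) \<pi>"
  by (simp add: acts_def)

section \<open>Images in, and preimages of, alternating groups\<close>

definition image_perms :: "(quat ^ 2 ^ 2) set \<Rightarrow> (nat \<Rightarrow> nat) set" where
  "image_perms K = {\<pi>. \<exists>g\<in>K. acts g \<pi>}"

lemma image_permsI: "g \<in> K \<Longrightarrow> acts g \<pi> \<Longrightarrow> \<pi> \<in> image_perms K"
  by (auto simp: image_perms_def)

lemma permutation_set_image_perms:
  assumes "subgroup K unitary_group" shows "permutation_set (image_perms K)"
proof
  have K: "K \<subseteq> carrier unitary_group" "mat 1 \<in> K" "\<And>g h. g \<in> K \<Longrightarrow> h \<in> K \<Longrightarrow> g ** h \<in> K"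
    "\<And>g. g \<in> K \<Longrightarrow> ctrans g \<in> K"
    using assms by (auto simp: subgroup_unitary_iff)
  fix p q
  show "bij p" if "p \<in> image_perms K"
    using that acts_permutes permutes_bij by (auto simp: image_perms_def)
  show "id \<in> image_perms K"
    using K(2) acts_one by (rule image_permsI)
  show "p \<circ> q \<in> image_perms K" if pq: "p \<in> image_perms K" "q \<in> image_perms K"
  proof -
    obtain g h where "g \<in> K" "acts g p" "h \<in> K" "acts h q"
      using pq by (auto simp: image_perms_def)
    then show ?thesis
      by (intro image_permsI[OF K(3) acts_mult])
  qed
  show "inv' p \<in> image_perms K" if p: "p \<in> image_perms K"
  proof -
    obtain g where "g \<in> K" "acts g p"
      using p by (auto simp: image_perms_def)
    then show ?thesis
      using K(1) by (intro image_permsI[OF K(4) acts_ctrans]) auto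
  qed
qed

text \<open>Free of generators: membership is read off from the permutation alone. Since A_5 sits in
  A_6 as the stabilizer of 6, the values n = 6 and n = 5 describe \<open>G\<close> and
  \<open>H\<close> side by side.\<close>

definition alt_lift :: "nat \<Rightarrow> (quat ^ 2 ^ 2) set" where
  "alt_lift n = {g \<in> carrier unitary_group. \<exists>\<pi>\<in>carrier (alt_group n). acts g \<pi>}"

lemma subgroup_alt_lift: "subgroup (alt_lift n) unitary_group"
  unfolding subgroup_unitary_iff
proof (intro conjI ballI)
  show "mat 1 \<in> alt_lift n"
    using acts_one monoid.one_closed[OF group.is_monoid[OF alt_group_is_group[of n]]] U.one_closed
    by (auto simp: alt_lift_def alt_group_one)
  show "g ** h \<in> alt_lift n" if gh: "g \<in> alt_lift n" "h \<in> alt_lift n" for g h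
  proof -
    obtain \<pi> \<rho> where "\<pi> \<in> carrier (alt_group n)" "acts g \<pi>" "\<rho> \<in> carrier (alt_group n)" "acts h \<rho>"
      using gh by (auto simp: alt_lift_def)
    then have "\<pi> \<circ> \<rho> \<in> carrier (alt_group n)" "acts (g ** h) (\<pi> \<circ> \<rho>)"
      by (simp_all add: acts_mult comp_in_alt_group)
    moreover have "g ** h \<in> carrier unitary_group"
      using gh U.m_closed[of g h] by (simp add: alt_lift_def)
    ultimately show ?thesis
      by (auto simp: alt_lift_def)
  qed
  show "ctrans g \<in> alt_lift n" if g: "g \<in> alt_lift n" for g
  proof -
    obtain \<pi> where "\<pi> \<in> carrier (alt_group n)" "acts g \<pi>" "g \<in> carrier unitary_group"
      using g by (auto simp: alt_lift_def)
    then show ?thesis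
      unfolding alt_lift_def using acts_ctrans alt_group_inv_closed ctrans_unitary by blast
  qed
qed (auto simp: alt_lift_def)

lemma alt_lift_mono: "m \<le> n \<Longrightarrow> alt_lift m \<subseteq> alt_lift n"
  using alt_group_mono[of m n] by (auto simp: alt_lift_def)

text \<open>The matrix \<open>b3\<close> squares to \<open>-1\<close> and acts as an even permutation, so a subgroup surjecting onto
  an alternating group contains the kernel \<open>\<plusminus>1\<close>.\<close>

lemma b3_square: "b3 ** b3 = - mat 1"
  unfolding b3_def by (simp add: mat2_eq_iff quat_eq_iff algebra_simps)

lemma minus_one_mem:
  assumes "subgroup K unitary_group" "g \<in> K" "acts g \<pi>" "acts b \<pi>" "b \<in> carrier unitary_group" "b ** b = - mat 1"
  shows "- mat 1 \<in> K"
proof -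
  have "g = b \<or> g = - b"
    using assms by (intro acts_same_imp) (auto simp: subgroup_unitary_iff)
  \<comment> \<open>The undetermined sign of \<open>g\<close> disappears on squaring.\<close>
  then have "g ** g = - mat 1"
    using assms(6) by auto
  then show ?thesis
    using assms(1,2) by (metis subgroup_unitary_iff)
qed

lemma mem_if_acts_same:
  assumes "subgroup K unitary_group" "- mat 1 \<in> K" "g \<in> K" "acts g \<pi>" "acts h \<pi>" "h \<in> carrier unitary_group"
  shows "h \<in> K"
proof -
  have "h = g \<or> h = - mat 1 ** g"
    using acts_same_imp[of h g \<pi>] assms by (auto simp: subgroup_unitary_iff)
  then show ?thesis
    using assms(1-3) by (metis subgroup_unitary_iff)
qed

lemma b3_unitary: "b3 \<in> carrier unitary_group"
  using generators_unitary by blast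

text \<open>Two lifts of one permutation differ by a sign, so a subgroup containing -1 and one lift
  of each even permutation contains all lifts. The bound on \<open>n\<close> puts the permutation of
  \<open>b3\<close> into the alternating group, which yields -1.\<close>

lemma alt_lift_subset:
  assumes "subgroup K unitary_group" "carrier (alt_group n) \<subseteq> image_perms K" "5 \<le> n"
  shows "alt_lift n \<subseteq> K"
proof
  have "cycle_of_list [1, 3] \<circ> cycle_of_list [2, 4] \<in> image_perms K"
    using generators_even(3) alt_group_mono assms(2,3) by blast
  then have minus: "- mat 1 \<in> K"
    using minus_one_mem[OF assms(1) _ _ generators_permute(3) b3_unitary b3_square]
    by (auto simp: image_perms_def)
  fix h assume "h \<in> alt_lift n"
  then obtain \<pi> where "h \<in> carrier unitary_group" "\<pi> \<in> image_perms K" "acts h \<pi>"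
    using assms(2) by (auto simp: alt_lift_def)
  then show "h \<in> K"
    using mem_if_acts_same[OF assms(1) minus] by (auto simp: image_perms_def)
qed

lemma generate_eq_alt_lift_5: "generate unitary_group {b3, g2} = alt_lift 5"
proof
  have gens: "{b3, g2} \<subseteq> carrier unitary_group"
    using generators_unitary by simp
  show "generate unitary_group {b3, g2} \<subseteq> alt_lift 5"
    using gens generators_even generators_permute by (intro U.generate_subgroup_incl subgroup_alt_lift) (auto simp: alt_lift_def)
  have sub: "subgroup (generate unitary_group {b3, g2}) unitary_group"
    by (rule U.generate_is_subgroup[OF gens])
  interpret permutation_set "image_perms (generate unitary_group {b3, g2})"
    by (rule permutation_set_image_perms[OF sub])
  show "alt_lift 5 \<subseteq> generate unitary_group {b3, g2}"
  proof (rule alt_lift_subset[OF sub])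
    show "carrier (alt_group 5) \<subseteq> image_perms (generate unitary_group {b3, g2})"
      by (rule alt_group_5_subset; rule image_permsI[OF _ generators_permute(5)] image_permsI[OF _ generators_permute(3)];
          intro generate.incl; simp)
  qed simp
qed

lemma subgroup_generate_b: "subgroup (generate unitary_group {b1, b2, b3, b4}) unitary_group"
  using generators_unitary by (intro U.generate_is_subgroup) simp

lemma alt_group_6_subset: "carrier (alt_group 6) \<subseteq> image_perms (generate unitary_group {b1, b2, b3, b4})"
proof -
  let ?P = "image_perms (generate unitary_group {b1, b2, b3, b4})"
  interpret permutation_set ?P
    by (rule permutation_set_image_perms[OF subgroup_generate_b])
  let ?p1 = "cycle_of_list [6, 1, 3] \<circ> cycle_of_list [2, 4, 5 :: nat]"
    and ?p2 = "cycle_of_list [6, 2] \<circ> cycle_of_list [3, 5 :: nat]"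
    and ?p3 = "cycle_of_list [1, 3] \<circ> cycle_of_list [2, 4 :: nat]"
    and ?p4 = "cycle_of_list [6, 3] \<circ> cycle_of_list [2, 5 :: nat]"
  have p: "?p1 \<in> ?P" "?p2 \<in> ?P" "?p3 \<in> ?P" "?p4 \<in> ?P"
    by (rule image_permsI[OF generate.incl generators_permute(1)] image_permsI[OF generate.incl generators_permute(2)]
        image_permsI[OF generate.incl generators_permute(3)] image_permsI[OF generate.incl generators_permute(4)]; simp)+
  \<comment> \<open>The word reproduces the permutation of \<open>g2\<close>, so the result for
    degree five applies to \<open>G\<close> as well.\<close>
  have word: "?p3 \<circ> (?p4 \<circ> (?p3 \<circ> (?p2 \<circ> (?p1 \<circ> ?p3)))) = cycle_of_list [1, 2, 3, 4, 5]"
    by (rule permutes_6_eqI; (intro permutes_compose cycle_of_list_permutes)?; simp add: Transposition.transpose_def)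
  have "cycle_of_list [1, 2, 3, 4, 5] \<in> ?P"
    unfolding word[symmetric] by (intro comp_mem p)
  then have A5: "carrier (alt_group 5) \<subseteq> ?P"
    using p(3) by (rule alt_group_5_subset)
  \<comment> \<open>\<open>?p4\<close> exchanges 6 with 3 and 2 with 5, hence carries (1 5 3) to (1
    2 6), the one cycle (1 2 k) that moves 6.\<close>
  have "cycle_of_list [1, 5, 3] \<in> ?P"
    using three_cycle_in_alt_group[of 1 5 3 5] A5 by auto
  then have c126: "cycle_of_list [1, 2, 6] \<in> ?P"
    using conj_mem[OF p(4), of "[1, 5, 3]"] by (simp add: Transposition.transpose_def)
  show ?thesis
  proof (rule alt_group_subset_of_cycles_1_2)
    fix k :: nat assume k: "k \<in> {3..6}"
    show "cycle_of_list [1, 2, k] \<in> ?P"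
    proof (cases "k = 6")
      case False
      then show ?thesis
        using three_cycle_in_alt_group[of 1 2 k 5] A5 k by auto
    qed (simp only: c126)
  qed
qed

lemma generate_eq_alt_lift_6: "generate unitary_group {b1, b2, b3, b4} = alt_lift 6"
proof
  show "generate unitary_group {b1, b2, b3, b4} \<subseteq> alt_lift 6"
    using generators_unitary generators_even generators_permute alt_group_mono[of 5 6]
    by (intro U.generate_subgroup_incl subgroup_alt_lift) (auto simp: alt_lift_def)
  show "alt_lift 6 \<subseteq> generate unitary_group {b1, b2, b3, b4}"
    by (rule alt_lift_subset[OF subgroup_generate_b alt_group_6_subset]) simp
qed

text \<open>Lifts are not constructed entry by entry: they exist because words in the generators
  realize every even permutation of the vertices.\<close>

lemma alt_lift_surj:
  assumes "\<pi> \<in> carrier (alt_group n)" "n \<le> 6"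
  obtains g where "g \<in> alt_lift n" "acts g \<pi>"
proof -
  have "\<pi> \<in> carrier (alt_group 6)"
    using alt_group_mono[OF assms(2)] assms(1) by (rule subsetD)
  then obtain g where "g \<in> generate unitary_group {b1, b2, b3, b4}" "acts g \<pi>"
    using alt_group_6_subset by (auto simp: image_perms_def)
  then show ?thesis
    using that assms(1) by (auto simp: generate_eq_alt_lift_6 alt_lift_def)
qed

section \<open>The double covers\<close>

lemma minus_one_neq_one: "- mat 1 \<noteq> (mat 1 :: quat ^ 2 ^ 2)"
  by (simp add: mat2_eq_iff quat_eq_iff)

lemma minus_one_in_alt_lift: "- mat 1 \<in> alt_lift n"
  using acts_uminus[OF acts_one] monoid.one_closed[OF group.is_monoid[OF alt_group_is_group[of n]]]
    minus_unitary[OF U.one_closed]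
  by (auto simp: alt_lift_def alt_group_one)

context
  fixes n :: nat
  assumes n: "5 \<le> n" "n \<le> 6"
begin

text \<open>Uniqueness of the induced permutation makes the description a function. The three facts
  are the input of the first isomorphism theorem, which gives the order 2 * (n! / 2) and the
  quotient of the double cover.\<close>

lemma alt_lift_hom:
  defines "h \<equiv> \<lambda>g. THE \<pi>. acts g \<pi>"
  shows "group_hom (unitary_subgroup (alt_lift n)) (alt_group n) h"
    and "kernel (unitary_subgroup (alt_lift n)) (alt_group n) h = {mat 1, - mat 1}"
    and "h ` carrier (unitary_subgroup (alt_lift n)) = carrier (alt_group n)"
proof -
  have h: "h g = \<pi>" if "g \<in> alt_lift n" "acts g \<pi>" for g \<pi>
    unfolding h_def using that acts_unique by (intro the_equality) (auto simp: alt_lift_def)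
  have h_acts: "acts g (h g)" "h g \<in> carrier (alt_group n)" if "g \<in> alt_lift n" for g
    using that h by (auto simp: alt_lift_def)
  have closed: "g ** g' \<in> alt_lift n" if "g \<in> alt_lift n" "g' \<in> alt_lift n" for g g'
    using that subgroup_alt_lift by (auto simp: subgroup_unitary_iff)
  show "group_hom (unitary_subgroup (alt_lift n)) (alt_group n) h"
    unfolding group_hom_def group_hom_axioms_def
    by (intro conjI U.subgroup_imp_group subgroup_alt_lift alt_group_is_group homI)
      (simp_all add: alt_group_mult h_acts h closed acts_mult)
  show "h ` carrier (unitary_subgroup (alt_lift n)) = carrier (alt_group n)"
  proof
    show "carrier (alt_group n) \<subseteq> h ` carrier (unitary_subgroup (alt_lift n))"
    proof
      fix \<pi> assume "\<pi> \<in> carrier (alt_group n)"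
      then obtain g where "g \<in> alt_lift n" "acts g \<pi>"
        using alt_lift_surj n(2) by blast
      then show "\<pi> \<in> h ` carrier (unitary_subgroup (alt_lift n))"
        using h by (intro image_eqI[of _ _ g]) simp_all
    qed
  qed (auto simp: h_acts)
  show "kernel (unitary_subgroup (alt_lift n)) (alt_group n) h = {mat 1, - mat 1}"
  proof
    show "kernel (unitary_subgroup (alt_lift n)) (alt_group n) h \<subseteq> {mat 1, - mat 1}"
    proof
      fix g assume "g \<in> kernel (unitary_subgroup (alt_lift n)) (alt_group n) h"
      then have "g \<in> alt_lift n" "h g = id"
        by (simp_all add: kernel_def alt_group_one)
      then show "g \<in> {mat 1, - mat 1}"
        using acts_id_imp[of g] h_acts(1)[of g] by (auto simp: alt_lift_def)
    qed
    have "mat 1 \<in> alt_lift n"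
      using subgroup_alt_lift by (simp add: subgroup_unitary_iff)
    then show "{mat 1, - mat 1} \<subseteq> kernel (unitary_subgroup (alt_lift n)) (alt_group n) h"
      using h[OF _ acts_one] h[OF minus_one_in_alt_lift acts_uminus[OF acts_one]] minus_one_in_alt_lift
      by (simp add: kernel_def alt_group_one)
  qed
qed

lemma card_alt_lift: "card (alt_lift n) = fact n"
proof -
  let ?K = "unitary_subgroup (alt_lift n)" and ?Z = "{mat 1, - mat 1} :: (quat ^ 2 ^ 2) set"
  note hom = alt_lift_hom
  interpret group_hom ?K "alt_group n" "\<lambda>g. THE \<pi>. acts g \<pi>"
    by (rule hom(1))
  have "subgroup ?Z ?K"
    using subgroup_kernel by (simp add: hom(2))
  then have "card (rcosets\<^bsub>?K\<^esub> ?Z) * card ?Z = order ?K"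
    by (rule G.lagrange)
  moreover have "card (rcosets\<^bsub>?K\<^esub> ?Z) = card (carrier (alt_group n))"
    using iso_same_card[OF FactGroup_iso[OF hom(3)]] by (simp add: hom(2) FactGroup_def)
  ultimately show ?thesis
    using alt_group_card_carrier[of n] n minus_one_neq_one by (auto simp: order_def)
qed

text \<open>The commutator of (1 2 3) and (1 4 3) is (1 3)(2 4), the permutation of
  \<open>b3\<close>. Whatever lifts are chosen, their commutator is thus
  \<plusminus>\<open>b3\<close>, with square -1. This is the stem condition that rules out a split
  extension.\<close>

lemma minus_one_in_derived: "- mat 1 \<in> derived unitary_group (alt_lift n)"
proof -
  let ?D = "derived unitary_group (alt_lift n)"
  let ?p = "cycle_of_list [1, 2, 3 :: nat]" and ?q = "cycle_of_list [1, 4, 3 :: nat]"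
  obtain g where g: "g \<in> alt_lift n" "acts g ?p"
    using alt_lift_surj[OF three_cycle_in_alt_group[of 1 2 3 n] n(2)] n by auto
  obtain h where h: "h \<in> alt_lift n" "acts h ?q"
    using alt_lift_surj[OF three_cycle_in_alt_group[of 1 4 3 n] n(2)] n by auto
  have U: "g \<in> carrier unitary_group" "h \<in> carrier unitary_group"
    using g h by (simp_all add: alt_lift_def)
  have inv: "inv' ?p = cycle_of_list [3, 2, 1]" "inv' ?q = cycle_of_list [3, 4, 1]"
    by (rule inv_cycle_of_list3; simp)+
  have "acts (g ** h ** ctrans g ** ctrans h) (?p \<circ> ?q \<circ> inv' ?p \<circ> inv' ?q)"
    using g h U by (intro acts_mult acts_ctrans)
  moreover have "?p \<circ> ?q \<circ> cycle_of_list [3, 2, 1] \<circ> cycle_of_list [3, 4, 1]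
      = cycle_of_list [1, 3] \<circ> cycle_of_list [2, 4]"
    by (rule permutes_6_eqI; (intro permutes_compose cycle_of_list_permutes)?; simp add: Transposition.transpose_def)
  ultimately have acts: "acts (g ** h ** ctrans g ** ctrans h) (cycle_of_list [1, 3] \<circ> cycle_of_list [2, 4])"
    by (simp only: inv)
  have "g ** h ** ctrans g ** ctrans h \<in> derived_set unitary_group (alt_lift n)"
    by (rule UN_I[OF g(1)], rule UN_I[OF h(1)]) (simp add: inv_unitary_group U)
  then have "g ** h ** ctrans g ** ctrans h \<in> ?D"
    unfolding derived_def by (rule generate.incl)
  moreover have "subgroup ?D unitary_group"
    by (rule U.derived_is_subgroup) (auto simp: alt_lift_def)
  ultimately show ?thesis
    using minus_one_mem acts generators_permute(3) b3_unitary b3_square by blast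
qed

lemma double_cover_alt_lift: "is_double_cover_alt n (unitary_subgroup (alt_lift n))"
  unfolding is_double_cover_alt_def
proof (intro conjI exI[of _ "{mat 1, - mat 1}"])
  let ?K = "unitary_subgroup (alt_lift n)" and ?Z = "{mat 1, - mat 1} :: (quat ^ 2 ^ 2) set"
  note hom = alt_lift_hom
  interpret group_hom ?K "alt_group n" "\<lambda>g. THE \<pi>. acts g \<pi>"
    by (rule hom(1))
  show "group ?K"
    by (rule G.is_group)
  show "subgroup ?Z ?K"
    using subgroup_kernel by (simp add: hom(2))
  show "card ?Z = 2"
    using minus_one_neq_one by auto
  show "\<forall>z\<in>?Z. \<forall>x\<in>carrier ?K. z \<otimes>\<^bsub>?K\<^esub> x = x \<otimes>\<^bsub>?K\<^esub> z"
    by auto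
  show "(?K Mod ?Z) \<cong> alt_group n"
    using FactGroup_iso[OF hom(3)] by (simp add: hom(2))
  have "subgroup (derived unitary_group (alt_lift n)) unitary_group"
    by (rule U.derived_is_subgroup) (auto simp: alt_lift_def)
  then have "?Z \<subseteq> derived unitary_group (alt_lift n)"
    using minus_one_in_derived by (simp add: subgroup_unitary_iff)
  then show "?Z \<subseteq> derived ?K (carrier ?K)"
    using U.derived_consistent[OF subset_refl subgroup_alt_lift] by simp
qed

end

section \<open>Reflections\<close>

lemma b1_cube: "b1 ** b1 ** b1 = mat 1"
  unfolding b1_def by (simp add: mat2_eq_iff quat_eq_iff algebra_simps)

lemma is_reflection_conj_b1:
  assumes "g \<in> carrier unitary_group" shows "is_reflection (g ** b1 ** ctrans g)"
  unfolding is_reflection_def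
proof (intro conjI exI)
  have b1: "b1 \<in> carrier unitary_group"
    using generators_unitary by simp
  show "g ** b1 ** ctrans g \<in> carrier unitary_group"
    using U.m_closed[OF U.m_closed[OF assms b1] ctrans_unitary[OF assms]] by simp
  show "g ** b1 ** ctrans g \<noteq> mat 1"
  proof
    assume "g ** b1 ** ctrans g = mat 1"
    then have "ctrans g ** (g ** b1 ** ctrans g) ** g = ctrans g ** g"
      by simp
    then have "b1 = mat 1"
      using unitary_cancel[OF assms] by (simp flip: matrix_mul_assoc)
    then show False
      by (simp add: b1_def mat2_eq_iff quat_eq_iff)
  qed
  let ?v = "g *v vector [1, 0]"
  have "?v \<noteq> 0"
  proof
    assume "?v = 0"
    then have "vector [1, 0] = (0 :: quat ^ 2)"
      using unitary_cancel(5)[OF assms, of "vector [1, 0]"] by simp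
    then show False
      by (simp add: vec2_eq_iff)
  qed
  then show "right_subspace (right_span {?v})" "has_right_dim (right_span {?v}) (CARD(2) - 1)"
    using is_line_right_span[of ?v] by (simp_all add: is_line_def One_nat_def)
  have "b1 *v vector [1, 0] = vector [1, 0]"
    by (simp add: b1_def vec2_eq_iff)
  then have "(g ** b1 ** ctrans g) *v ?v = ?v"
    by (simp add: unitary_cancel(5)[OF assms] flip: matrix_vector_mul_assoc)
  then show "\<forall>v\<in>right_span {?v}. (g ** b1 ** ctrans g) *v v = v"
    by (auto simp: right_span_singleton matrix_vector_rscale)
qed

text \<open>Of the four generators only \<open>b1\<close> is a reflection: the others square to -1
  and fix no nonzero vector. Hence the normal closure of \<open>b1\<close> is taken and shown to
  contain the other three.\<close>

lemma alt_lift_6_generated_by_reflections: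
  "alt_lift 6 = generate unitary_group {g ** b1 ** ctrans g | g. g \<in> alt_lift 6}"
proof
  let ?R = "{g ** b1 ** ctrans g | g. g \<in> alt_lift 6}"
  let ?N = "generate unitary_group ?R"
  have L: "alt_lift 6 \<subseteq> carrier unitary_group" "mat 1 \<in> alt_lift 6"
    "\<And>g h. g \<in> alt_lift 6 \<Longrightarrow> h \<in> alt_lift 6 \<Longrightarrow> g ** h \<in> alt_lift 6" "\<And>g. g \<in> alt_lift 6 \<Longrightarrow> ctrans g \<in> alt_lift 6"
    using subgroup_alt_lift[of 6] by (auto simp: subgroup_unitary_iff)
  have b: "b1 \<in> alt_lift 6" "b2 \<in> alt_lift 6" "b3 \<in> alt_lift 6" "b4 \<in> alt_lift 6"
    by (auto simp flip: generate_eq_alt_lift_6 intro: generate.incl)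
  have R: "?R \<subseteq> alt_lift 6"
    using L(3,4) b(1) by auto
  then show "?N \<subseteq> alt_lift 6"
    by (intro U.generate_subgroup_incl subgroup_alt_lift)
  have sub: "subgroup ?N unitary_group"
    using R L(1) by (intro U.generate_is_subgroup) blast
  have normal: "a ** x ** ctrans a \<in> ?N" if a: "a \<in> alt_lift 6" and x: "x \<in> ?N" for a x
    using x
  proof induction
    case one
    then show ?case
      using a L(1) unitary_cancel(2)[of a] generate.one[of unitary_group ?R] by auto
  next
    case (incl x)
    then obtain g where "g \<in> alt_lift 6" "x = g ** b1 ** ctrans g"
      by blast
    then have "a ** x ** ctrans a = (a ** g) ** b1 ** ctrans (a ** g)"
      by (simp add: ctrans_mult matrix_mul_assoc)
    then show ?case
      using a L(3) \<open>g \<in> alt_lift 6\<close> by (intro generate.incl) blast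
  next
    case (inv x)
    then obtain g where g: "g \<in> alt_lift 6" "x = g ** b1 ** ctrans g"
      by blast
    have x: "x \<in> carrier unitary_group"
      using inv R L(1) by blast
    have "ctrans (a ** x ** ctrans a) \<in> ?N"
    proof -
      have "a ** x ** ctrans a = (a ** g) ** b1 ** ctrans (a ** g)"
        by (simp add: g ctrans_mult matrix_mul_assoc)
      then have "a ** x ** ctrans a \<in> ?N"
        using a L(3) g by (intro generate.incl) blast
      then show ?thesis
        using sub by (simp add: subgroup_unitary_iff)
    qed
    then show ?case
      by (simp add: inv_unitary_group[OF x] ctrans_mult matrix_mul_assoc)
  next
    case (eng x y)
    have "a ** (x ** y) ** ctrans a = (a ** x ** ctrans a) ** (a ** y ** ctrans a)"
      using a L(1) unitary_cancel(3)[of a] by (auto simp flip: matrix_mul_assoc)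
    then show ?case
      using generate.eng[OF eng.IH] by simp
  qed
  interpret permutation_set "image_perms ?N"
    by (rule permutation_set_image_perms[OF sub])
  \<comment> \<open>Normality passes to permutations because every even \<tau> has a lift.\<close>
  have conj: "\<tau> \<circ> \<pi> \<circ> inv' \<tau> \<in> image_perms ?N"
    if \<pi>: "\<pi> \<in> image_perms ?N" and \<tau>: "\<tau> \<in> carrier (alt_group 6)" for \<pi> \<tau>
  proof -
    obtain x where x: "x \<in> ?N" "acts x \<pi>"
      using \<pi> by (auto simp: image_perms_def)
    obtain a where a: "a \<in> alt_lift 6" "acts a \<tau>"
      using alt_lift_surj[OF \<tau>] by blast
    show ?thesis
      using normal[OF a(1) x(1)] acts_mult[OF acts_mult[OF a(2) x(2)] acts_ctrans[OF _ a(2)]] a(1) L(1)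
      by (intro image_permsI) auto
  qed
  let ?p1 = "cycle_of_list [6, 1, 3] \<circ> cycle_of_list [2, 4, 5 :: nat]"
    and ?p2 = "cycle_of_list [6, 2] \<circ> cycle_of_list [3, 5 :: nat]"
    and ?p3 = "cycle_of_list [1, 3] \<circ> cycle_of_list [2, 4 :: nat]"
    and ?p4 = "cycle_of_list [6, 3] \<circ> cycle_of_list [2, 5 :: nat]"
  \<comment> \<open>\<open>?i1\<close> and \<open>?t\<close> are the inverses of \<open>?p1\<close>
    and \<open>?s\<close>, and \<open>?u\<close> is an involution. The even permutation
    \<open>?s\<close> is chosen so that \<open>?p1\<close> times the conjugate of its inverse by
    \<open>?s\<close> equals \<open>?p2\<close>; \<open>?u\<close> and (6 3 2) conjugate
    \<open>?p2\<close> to \<open>?p3\<close> and \<open>?p4\<close>.\<close>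
  let ?i1 = "cycle_of_list [3, 1, 6] \<circ> cycle_of_list [5, 4, 2 :: nat]"
    and ?s = "cycle_of_list [1, 3, 2] \<circ> cycle_of_list [4, 5, 6 :: nat]"
    and ?t = "cycle_of_list [2, 3, 1] \<circ> cycle_of_list [6, 5, 4 :: nat]"
    and ?u = "cycle_of_list [6, 4] \<circ> cycle_of_list [5, 1 :: nat]"
  have b1_R: "b1 \<in> ?R"
    using L(2) by (auto intro!: exI[of _ "mat 1"])
  then have b1_N: "b1 \<in> ?N"
    by (rule generate.incl)
  then have p1: "?p1 \<in> image_perms ?N"
    using generators_permute(1) by (rule image_permsI)
  have i: "inv' ?p1 = ?i1" "inv' ?s = ?t" "inv' ?u = ?u" "inv' (cycle_of_list [6, 3, 2 :: nat]) = cycle_of_list [2, 3, 6]"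
    by (rule inv_unique_comp; rule permutes_6_eqI; (intro permutes_compose cycle_of_list_permutes permutes_id)?;
        simp add: Transposition.transpose_def)+
  have "?s \<in> carrier (alt_group 6)" "?u \<in> carrier (alt_group 6)" "cycle_of_list [6, 3, 2] \<in> carrier (alt_group 6)"
    by (intro comp_in_alt_group three_cycle_in_alt_group double_transposition_in_alt_group; simp)+
  note conj' = conj[OF _ this(1)] conj[OF _ this(2)] conj[OF _ this(3)]
  have "?p1 \<circ> (?s \<circ> ?i1 \<circ> ?t) \<in> image_perms ?N"
    using comp_mem[OF p1 conj'(1)[OF inv_mem[OF p1]]] by (simp only: i)
  moreover have "?p1 \<circ> (?s \<circ> ?i1 \<circ> ?t) = ?p2"
    by (rule permutes_6_eqI; (intro permutes_compose cycle_of_list_permutes)?; simp add: Transposition.transpose_def)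
  ultimately have p2: "?p2 \<in> image_perms ?N"
    by (simp only:)
  have "?u \<circ> ?p2 \<circ> ?u = ?p3" "cycle_of_list [6, 3, 2] \<circ> ?p2 \<circ> cycle_of_list [2, 3, 6] = ?p4"
    by (rule permutes_6_eqI; (intro permutes_compose cycle_of_list_permutes)?; simp add: Transposition.transpose_def)+
  then have p34: "?p3 \<in> image_perms ?N" "?p4 \<in> image_perms ?N"
    using conj'(2,3)[OF p2] by (simp_all only: i)
  have minus: "- mat 1 \<in> ?N"
    using p34(1) minus_one_mem[OF sub _ _ generators_permute(3) b3_unitary b3_square] by (auto simp: image_perms_def)
  have "b2 \<in> ?N" "b3 \<in> ?N" "b4 \<in> ?N"
    using p2 p34 mem_if_acts_same[OF sub minus _ _ generators_permute(2)] mem_if_acts_same[OF sub minus _ _ generators_permute(3)]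
      mem_if_acts_same[OF sub minus _ _ generators_permute(4)] generators_unitary
    by (auto simp: image_perms_def simp del: cycle_of_list.simps)
  then have "generate unitary_group {b1, b2, b3, b4} \<subseteq> ?N"
    using b1_N by (intro U.generate_subgroup_incl[OF _ sub]) auto
  then show "alt_lift 6 \<subseteq> ?N"
    by (simp only: generate_eq_alt_lift_6)
qed

lemma is_reflection_group_alt_lift_6: "is_reflection_group (alt_lift 6)"
  unfolding is_reflection_group_def
proof (intro exI conjI)
  show "\<forall>g\<in>{g ** b1 ** ctrans g | g. g \<in> alt_lift 6}. is_reflection g"
    using is_reflection_conj_b1 by (auto simp: alt_lift_def)
qed (rule alt_lift_6_generated_by_reflections)

section \<open>Primitivity\<close>

text \<open>The diagonal entries 1 and \<omega> of \<open>b1\<close> are not conjugate, so an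
  invariant line cannot involve both coordinates: a nonzero first coordinate makes the scalar 1, and
  \<omega> - 1 then annihilates the second.\<close>

lemma b1_invariant_line:
  assumes S: "right_subspace S" "S \<noteq> {0}" "S \<noteq> UNIV" and inv: "\<And>v. v \<in> S \<Longrightarrow> b1 *v v \<in> S"
  shows "S = right_span {vector [1, 0]} \<or> S = right_span {vector [0, 1]}"
proof -
  obtain v where v: "v \<in> S" "v \<noteq> 0"
    using S(1,2) right_subspaceD(1) by blast
  then have S_eq: "S = right_span {v}"
    using right_subspace_line S by blast
  then obtain a where a: "b1 *v v = v \<cdot> a"
    using inv[OF v(1)] by (auto simp: right_span_singleton)
  have "v $ 2 = 0" if "v $ 1 \<noteq> 0"
  proof -
    have "v $ 1 * a = v $ 1" "Quat (- 1 / 2) (sqrt 3 / 2) 0 0 * v $ 2 = v $ 2 * a"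
      using a by (simp_all add: b1_def vec2_eq_iff)
    then have "(Quat (- 1 / 2) (sqrt 3 / 2) 0 0 - 1) * v $ 2 = 0"
      using that by (simp add: algebra_simps)
    moreover have "Quat (- 1 / 2) (sqrt 3 / 2) 0 0 - 1 \<noteq> 0"
      by (simp add: quat_eq_iff)
    ultimately show ?thesis
      by (simp only: mult_eq_0_iff) simp
  qed
  then have "v = vector [1, 0] \<cdot> (v $ 1) \<or> v = vector [0, 1] \<cdot> (v $ 2)"
    by (auto simp: vec2_eq_iff)
  then show ?thesis
    using right_span_singleton_eq v(2) in_right_span_singleton(1) unfolding S_eq by metis
qed

text \<open>All four entries of \<open>b2\<close> are nonzero.\<close>

lemma b2_moves_axes:
  assumes "S = right_span {vector [1, 0]} \<or> S = right_span {vector [0, 1]}"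
  obtains v where "v \<in> S" "b2 *v v \<notin> right_span {vector [1, 0]}" "b2 *v v \<notin> right_span {vector [0, 1]}"
proof -
  have "b2 *v vector [1, 0] \<notin> right_span {vector [1, 0]}" "b2 *v vector [1, 0] \<notin> right_span {vector [0, 1]}"
    "b2 *v vector [0, 1] \<notin> right_span {vector [1, 0]}" "b2 *v vector [0, 1] \<notin> right_span {vector [0, 1]}"
    unfolding generators_sqrt by (auto simp: right_span_singleton vec2_eq_iff quat_eq_iff)
  then show ?thesis
    using assms that in_right_span_singleton(2) by metis
qed

lemma irreducible_b1_b2: "b1 \<in> G \<Longrightarrow> b2 \<in> G \<Longrightarrow> irreducible_group G"
  unfolding irreducible_group_def invariant_def
proof (intro allI impI, rule ccontr)
  fix S assume b: "b1 \<in> G" "b2 \<in> G" and S: "right_subspace S \<and> (\<forall>g\<in>G. \<forall>v\<in>S. g *v v \<in> S)"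
    and "\<not> (S = {0} \<or> S = UNIV)"
  then have axes: "S = right_span {vector [1, 0]} \<or> S = right_span {vector [0, 1]}"
    using b1_invariant_line[of S] by blast
  obtain v where "v \<in> S" "b2 *v v \<notin> right_span {vector [1, 0]}" "b2 *v v \<notin> right_span {vector [0, 1]}"
    by (rule b2_moves_axes[OF axes])
  then show False
    using S b(2) axes by blast
qed

text \<open>A decomposition has at most two summands, while orbits of \<open>b1\<close>, of order 3,
  have length 1 or 3. So \<open>b1\<close> preserves each summand, each summand is a coordinate
  axis, and \<open>b2\<close> moves it off both axes.\<close>

lemma primitive_b1_b2:
  assumes b: "b1 \<in> G" "b2 \<in> G" shows "primitive_group G"
  unfolding primitive_group_def
proof (intro conjI notI irreducible_b1_b2[OF b])
  assume "\<exists>\<V>. is_direct_sum \<V> UNIV \<and> (\<forall>V\<in>\<V>. V \<noteq> {0} \<and> V \<noteq> UNIV) \<and>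
            (\<forall>g\<in>G. \<forall>V\<in>\<V>. (\<lambda>v. g *v v) ` V \<in> \<V>)"
  then obtain \<V> :: "(quat ^ 2) set set" where D: "is_direct_sum \<V> UNIV"
    "\<forall>V\<in>\<V>. V \<noteq> {0} \<and> V \<noteq> UNIV" "\<forall>g\<in>G. \<forall>V\<in>\<V>. (\<lambda>v. g *v v) ` V \<in> \<V>"
    by (elim exE conjE)
  have \<V>: "is_direct_sum \<V> UNIV" "\<And>V. V \<in> \<V> \<Longrightarrow> V \<noteq> {0}" "\<And>V. V \<in> \<V> \<Longrightarrow> V \<noteq> UNIV"
    "\<And>g V. g \<in> G \<Longrightarrow> V \<in> \<V> \<Longrightarrow> (\<lambda>v. g *v v) ` V \<in> \<V>"
    using D by simp_all
  have sub: "right_subspace V" if "V \<in> \<V>" for V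
    using \<V>(1) that by (simp add: is_direct_sum_def)
  let ?b = "\<lambda>V. (\<lambda>v. b1 *v v) ` V"
  have cube: "?b (?b (?b V)) = V" for V
    using b1_cube by (simp add: image_image matrix_vector_mul_assoc matrix_mul_assoc)
  have fixed: "?b V = V" if V: "V \<in> \<V>" for V
  proof (rule ccontr)
    assume neq: "?b V \<noteq> V"
    have mem: "?b V \<in> \<V>" "?b (?b V) \<in> \<V>"
      using \<V>(4)[OF b(1)] V by blast+
    have "?b (?b V) \<noteq> V" "?b (?b V) \<noteq> ?b V"
      using neq cube by metis+
    then show False
      using direct_sum_plane_card_le_2[OF \<V>(1) V mem] neq \<V>(2) V mem by metis
  qed
  have axes: "V = right_span {vector [1, 0]} \<or> V = right_span {vector [0, 1]}" if "V \<in> \<V>" for V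
    using b1_invariant_line[OF sub \<V>(2,3)] that fixed[OF that] by blast
  have "\<V> \<noteq> {}"
  proof
    assume "\<V> = {}"
    then have "(UNIV :: (quat ^ 2) set) = {0}"
      using \<V>(1) by (auto simp: is_direct_sum_def)
    then have "vector [1, 0] = (0 :: quat ^ 2)"
      by blast
    then show False
      by (simp add: vec2_eq_iff)
  qed
  then obtain V where V: "V \<in> \<V>"
    by blast
  obtain v where "v \<in> V" "b2 *v v \<notin> right_span {vector [1, 0]}" "b2 *v v \<notin> right_span {vector [0, 1]}"
    using b2_moves_axes[OF axes[OF V]] .
  then show False
    using axes[OF \<V>(4)[OF b(2) V]] by blast
qed

section \<open>Rationality and trivial stabilizers\<close>

lemma sqrt_5_irrational: "sqrt 5 \<notin> \<rat>"
proof
  assume "sqrt 5 \<in> \<rat>"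
  then obtain m n :: nat where mn: "n \<noteq> 0" "\<bar>sqrt 5\<bar> = real m / real n" "coprime m n"
    by (rule Rats_abs_nat_div_natE)
  then have "(sqrt 5 * real n)\<^sup>2 = (real m)\<^sup>2"
    by simp
  then have "real (m\<^sup>2) = real (5 * n\<^sup>2)"
    by (simp add: power_mult_distrib)
  then have eq: "m\<^sup>2 = 5 * n\<^sup>2"
    by (simp only: of_nat_eq_iff)
  have prime: "prime (5 :: nat)"
    by simp
  have "5 dvd m"
    using prime eq by (metis dvd_triv_left prime_dvd_power)
  then obtain k where "m = 5 * k"
    by blast
  then have "n\<^sup>2 = 5 * k\<^sup>2"
    using eq by (simp add: power2_eq_square)
  then have "5 dvd n"
    using prime by (metis dvd_triv_left prime_dvd_power)
  then show False
    using \<open>5 dvd m\<close> mn(3) prime not_coprimeI not_prime_unit by blast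
qed

lemma rat_sqrt_5_independent:
  assumes "a \<in> \<rat>" "b \<in> \<rat>" "a + sqrt 5 * b = 0" shows "a = 0 \<and> b = 0"
proof -
  have "b = 0"
  proof (rule ccontr)
    assume "b \<noteq> 0"
    then have "sqrt 5 = - a / b"
      using assms(3) by (simp add: field_simps)
    then show False
      using sqrt_5_irrational assms(1,2) by (metis Rats_divide Rats_minus_iff)
  qed
  then show ?thesis
    using assms(3) by simp
qed

text \<open>The rational span of \<open>1\<close>, \<open>\<surd>3 i\<close>, \<open>\<surd>3 j\<close>, \<open>k\<close> is a quaternion algebra over the rationals. After
  conjugation by \<open>diag(1, \<surd>6)\<close> the generators have entries in it, whereas \<open>w\<close> and \<open>w\<^sup>\<bottom>\<close> need \<open>\<surd>5\<close>.\<close>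

definition rat_quat :: "quat \<Rightarrow> bool" where
  "rat_quat x \<longleftrightarrow> QRe x \<in> \<rat> \<and> QI x / sqrt 3 \<in> \<rat> \<and> QJ x / sqrt 3 \<in> \<rat> \<and> QK x \<in> \<rat>"

lemma rat_quatE:
  assumes "rat_quat x"
  obtains a b c d where "x = Quat a (sqrt 3 * b) (sqrt 3 * c) d" "a \<in> \<rat>" "b \<in> \<rat>" "c \<in> \<rat>" "d \<in> \<rat>"
  using assms that[of "QRe x" "QI x / sqrt 3" "QJ x / sqrt 3" "QK x"] by (simp add: rat_quat_def)

lemma rat_quat_Quat [simp]:
  "rat_quat (Quat a (sqrt 3 * b) (sqrt 3 * c) d) \<longleftrightarrow> a \<in> \<rat> \<and> b \<in> \<rat> \<and> c \<in> \<rat> \<and> d \<in> \<rat>"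
  by (simp add: rat_quat_def)

lemma rat_quat_add: "rat_quat x \<Longrightarrow> rat_quat y \<Longrightarrow> rat_quat (x + y)"
  by (simp add: rat_quat_def add_divide_distrib)

lemma rat_quat_diff: "rat_quat x \<Longrightarrow> rat_quat y \<Longrightarrow> rat_quat (x - y)"
  by (simp add: rat_quat_def diff_divide_distrib)

lemma rat_quat_scaleR: "r \<in> \<rat> \<Longrightarrow> rat_quat x \<Longrightarrow> rat_quat (r *\<^sub>R x)"
  by (simp add: rat_quat_def flip: times_divide_eq_right)

lemma rat_quat_qcnj: "rat_quat x \<Longrightarrow> rat_quat (qcnj x)"
  by (simp add: rat_quat_def)

text \<open>The structure constants are rational: for instance sqrt 3 i times sqrt 3 j is 3 k, and
  sqrt 3 j times k is sqrt 3 i.\<close>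

lemma rat_quat_mult:
  assumes "rat_quat x" "rat_quat y" shows "rat_quat (x * y)"
proof -
  obtain a b c d a' b' c' d' where xy: "x = Quat a (sqrt 3 * b) (sqrt 3 * c) d" "y = Quat a' (sqrt 3 * b') (sqrt 3 * c') d'"
    and rat: "a \<in> \<rat>" "b \<in> \<rat>" "c \<in> \<rat>" "d \<in> \<rat>" "a' \<in> \<rat>" "b' \<in> \<rat>" "c' \<in> \<rat>" "d' \<in> \<rat>"
    using assms by (auto elim!: rat_quatE)
  have "x * y = Quat (a * a' - 3 * (b * b') - 3 * (c * c') - d * d')
     (sqrt 3 * (a * b' + b * a' + c * d' - d * c')) (sqrt 3 * (a * c' - b * d' + c * a' + d * b'))
     (a * d' + 3 * (b * c') - 3 * (c * b') + d * a')"
    by (simp add: xy quat_eq_iff algebra_simps)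
  then show ?thesis
    using rat by simp
qed

lemma rat_quat_independent:
  assumes "rat_quat x" "rat_quat y" "x + sqrt 5 *\<^sub>R y = 0" shows "x = 0 \<and> y = 0"
proof -
  have "QI x / sqrt 3 + sqrt 5 * (QI y / sqrt 3) = (QI x + sqrt 5 * QI y) / sqrt 3"
    "QJ x / sqrt 3 + sqrt 5 * (QJ y / sqrt 3) = (QJ x + sqrt 5 * QJ y) / sqrt 3"
    by (simp_all add: add_divide_distrib)
  then show ?thesis
    using assms rat_sqrt_5_independent[of "QRe x" "QRe y"] rat_sqrt_5_independent[of "QK x" "QK y"]
      rat_sqrt_5_independent[of "QI x / sqrt 3" "QI y / sqrt 3"] rat_sqrt_5_independent[of "QJ x / sqrt 3" "QJ y / sqrt 3"]
    by (simp add: quat_eq_iff rat_quat_def)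
qed

text \<open>Conjugation by diag(1, sqrt 6) multiplies one off-diagonal entry by sqrt 6 and divides
  the other by it. The two differ by the rational factor 6, so the condition can be stated
  symmetrically, which makes it stable under \<open>ctrans\<close>.\<close>

definition rat_mat :: "quat ^ 2 ^ 2 \<Rightarrow> bool" where
  "rat_mat g \<longleftrightarrow> rat_quat (g $ 1 $ 1) \<and> rat_quat (g $ 2 $ 2) \<and>
     rat_quat (sqrt 6 *\<^sub>R g $ 1 $ 2) \<and> rat_quat (sqrt 6 *\<^sub>R g $ 2 $ 1)"

definition rat_vec :: "quat ^ 2 \<Rightarrow> bool" where
  "rat_vec v \<longleftrightarrow> rat_quat (v $ 1) \<and> rat_quat (sqrt 6 *\<^sub>R v $ 2)"

lemma rat_quat_mult_sqrt_6:
  assumes "rat_quat (sqrt 6 *\<^sub>R x)" "rat_quat (sqrt 6 *\<^sub>R y)" shows "rat_quat (x * y)"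
proof -
  have "x * y = (1 / 6) *\<^sub>R ((sqrt 6 *\<^sub>R x) * (sqrt 6 *\<^sub>R y))"
    by simp
  then show ?thesis
    using rat_quat_scaleR[OF _ rat_quat_mult[OF assms], of "1 / 6"] by simp
qed

lemma rat_quat_sqrt_6_mult:
  "rat_quat (sqrt 6 *\<^sub>R x) \<Longrightarrow> rat_quat y \<Longrightarrow> rat_quat (sqrt 6 *\<^sub>R (x * y))"
  "rat_quat x \<Longrightarrow> rat_quat (sqrt 6 *\<^sub>R y) \<Longrightarrow> rat_quat (sqrt 6 *\<^sub>R (x * y))"
  using rat_quat_mult[of "sqrt 6 *\<^sub>R x" y] rat_quat_mult[of x "sqrt 6 *\<^sub>R y"] by simp_all

lemma rat_mat_mult:
  assumes "rat_mat g" "rat_mat h" shows "rat_mat (g ** h)"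
  using assms
  by (simp add: rat_mat_def scaleR_right_distrib rat_quat_add rat_quat_mult rat_quat_mult_sqrt_6
      rat_quat_sqrt_6_mult del: mult_scaleR_left mult_scaleR_right)

lemma rat_vec_mult:
  assumes "rat_mat g" "rat_vec v" shows "rat_vec (g *v v)"
  using assms
  by (simp add: rat_mat_def rat_vec_def scaleR_right_distrib rat_quat_add rat_quat_mult rat_quat_mult_sqrt_6
      rat_quat_sqrt_6_mult del: mult_scaleR_left mult_scaleR_right)

lemma rat_mat_ctrans: "rat_mat g \<Longrightarrow> rat_mat (ctrans g)"
  using rat_quat_qcnj[of "sqrt 6 *\<^sub>R g $ 1 $ 2"] rat_quat_qcnj[of "sqrt 6 *\<^sub>R g $ 2 $ 1"]
  by (simp add: rat_mat_def rat_quat_qcnj)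

lemma rat_mat_generators: "g \<in> {b1, b2, b3, b4} \<Longrightarrow> rat_mat g"
  using real_sqrt_mult[of 2 3] unfolding generators_sqrt(1) b1_def b3_def b4_def
  by (auto simp: rat_mat_def rat_quat_def ac_simps)

lemma rat_mat_alt_lift: "g \<in> alt_lift 6 \<Longrightarrow> rat_mat g"
  unfolding generate_eq_alt_lift_6[symmetric]
proof (induction rule: generate.induct)
  case one
  then show ?case
    by (simp add: rat_mat_def rat_quat_def)
next
  case (inv h)
  then show ?case
    using generators_unitary rat_mat_ctrans[OF rat_mat_generators, of h] inv_unitary_group[of h] by auto
qed (simp_all add: rat_mat_generators rat_mat_mult)

lemma rat_mat_fixed_parts:
  assumes "rat_mat g" "rat_vec x" "rat_vec y" "g *v (x + sqrt 5 *\<^sub>R y) = x + sqrt 5 *\<^sub>R y"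
  shows "g *v x = x" "g *v y = y"
proof -
  have rat: "rat_vec (g *v x - x)" "rat_vec (g *v y - y)"
    using rat_vec_mult[OF assms(1,2)] rat_vec_mult[OF assms(1,3)] assms(2,3)
    by (simp_all add: rat_vec_def scaleR_right_diff_distrib rat_quat_diff)
  have zero: "(g *v x - x) + sqrt 5 *\<^sub>R (g *v y - y) = 0"
    using assms(4) by (simp add: matrix_vector_scaleR matrix_vector_right_distrib scaleR_right_diff_distrib algebra_simps)
  \<comment> \<open>Second coordinates enter the rational algebra only after scaling by sqrt 6, so
    the equation is scaled before its parts are compared.\<close>
  have "sqrt 6 *\<^sub>R (g *v x - x) $ 2 + sqrt 5 *\<^sub>R (sqrt 6 *\<^sub>R (g *v y - y) $ 2)
      = sqrt 6 *\<^sub>R ((g *v x - x) + sqrt 5 *\<^sub>R (g *v y - y)) $ 2"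
    by (simp add: algebra_simps)
  also have "\<dots> = 0"
    by (simp only: zero zero_index scaleR_zero_right)
  finally have "sqrt 6 *\<^sub>R (g *v x - x) $ 2 = 0 \<and> sqrt 6 *\<^sub>R (g *v y - y) $ 2 = 0"
    using rat by (intro rat_quat_independent) (simp_all only: rat_vec_def)
  moreover have "(g *v x - x) $ 1 + sqrt 5 *\<^sub>R (g *v y - y) $ 1 = 0"
    using arg_cong[OF zero, of "\<lambda>v. v $ 1"] by simp
  then have "(g *v x - x) $ 1 = 0 \<and> (g *v y - y) $ 1 = 0"
    using rat by (intro rat_quat_independent) (simp_all only: rat_vec_def)
  ultimately show "g *v x = x" "g *v y = y"
    by (simp_all add: vec2_eq_iff)
qed

lemma sqrt_10: "sqrt 10 = sqrt 2 * sqrt 5" and sqrt_6: "sqrt 6 = sqrt 2 * sqrt 3"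
  by (simp_all flip: real_sqrt_mult)

lemma stabilizer_w_vec:
  assumes "g \<in> alt_lift 6" "g *v w_vec = w_vec" shows "g = mat 1"
proof -
  \<comment> \<open>Division by sqrt 2 turns the first entry of \<open>w_vec\<close> into 1 + sqrt
    5, and the second is free of sqrt 5.\<close>
  let ?q = "Quat (sqrt 3 * sqrt 2 / 2) (- (sqrt 2 / 2)) (sqrt 2 / 2) (sqrt 3 * sqrt 2 / 2)"
  let ?x = "vector [1, ?q] :: quat ^ 2" and ?y = "vector [1, 0] :: quat ^ 2"
  have w: "w_vec = sqrt 2 *\<^sub>R (?x + sqrt 5 *\<^sub>R ?y)"
    by (simp add: w_vec_def vec2_eq_iff quat_eq_iff sqrt_10 algebra_simps)
  have rat: "rat_vec ?x" "rat_vec ?y"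
    by (simp_all add: rat_vec_def rat_quat_def sqrt_6 ac_simps)
  have "g *v (?x + sqrt 5 *\<^sub>R ?y) = ?x + sqrt 5 *\<^sub>R ?y"
    using assms(2) unfolding w by (simp add: matrix_vector_scaleR)
  then have xy: "g *v ?x = ?x" "g *v ?y = ?y"
    using rat_mat_fixed_parts[OF rat_mat_alt_lift[OF assms(1)] rat] by blast+
  have g1: "g $ 1 $ 1 = 1" "g $ 2 $ 1 = 0"
    using xy(2) by (simp_all add: vec2_eq_iff)
  have "g $ 1 $ 2 * ?q = 0" "(g $ 2 $ 2 - 1) * ?q = 0"
    using xy(1) g1 by (simp_all add: vec2_eq_iff algebra_simps)
  moreover have "?q \<noteq> 0"
    by (simp add: quat_eq_iff)
  ultimately show ?thesis
    using g1 by (simp add: mat2_eq_iff)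
qed

lemma stabilizer_w_perp:
  assumes "g \<in> alt_lift 6" "g *v w_perp = w_perp" shows "g = mat 1"
proof -
  \<comment> \<open>Division by sqrt 3 turns the second entry of \<open>w_perp\<close> into
    \<open>?r\<close> times 1 + sqrt 5, where \<open>?r\<close> is sqrt 6 / 3.\<close>
  let ?q = "Quat (- 1) (- (sqrt 3 / 3)) (sqrt 3 / 3) 1" and ?r = "Quat (sqrt 2 * sqrt 3 / 3) 0 0 0"
  let ?x = "vector [?q, ?r] :: quat ^ 2" and ?y = "vector [0, ?r] :: quat ^ 2"
  have w: "w_perp = sqrt 3 *\<^sub>R (?x + sqrt 5 *\<^sub>R ?y)"
    by (simp add: w_perp_def vec2_eq_iff quat_eq_iff sqrt_10 algebra_simps)
  have rat: "rat_vec ?x" "rat_vec ?y"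
    by (simp_all add: rat_vec_def rat_quat_def sqrt_6 ac_simps)
  have "g *v (?x + sqrt 5 *\<^sub>R ?y) = ?x + sqrt 5 *\<^sub>R ?y"
    using assms(2) unfolding w by (simp add: matrix_vector_scaleR)
  then have xy: "g *v ?x = ?x" "g *v ?y = ?y"
    using rat_mat_fixed_parts[OF rat_mat_alt_lift[OF assms(1)] rat] by blast+
  have "g $ 1 $ 2 * ?r = 0" "(g $ 2 $ 2 - 1) * ?r = 0"
    using xy(2) by (simp_all add: vec2_eq_iff algebra_simps)
  moreover have "?r \<noteq> 0" "?q \<noteq> 0"
    by (simp_all add: quat_eq_iff)
  ultimately have g2: "g $ 1 $ 2 = 0" "g $ 2 $ 2 = 1"
    by simp_all
  then have "(g $ 1 $ 1 - 1) * ?q = 0" "g $ 2 $ 1 * ?q = 0"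
    using xy(1) by (simp_all add: vec2_eq_iff algebra_simps)
  then show ?thesis
    using g2 \<open>?q \<noteq> 0\<close> by (simp add: mat2_eq_iff)
qed

section \<open>The eigenlines of the vertices\<close>

definition eigenline :: "real \<Rightarrow> nat \<Rightarrow> (quat ^ 2) set" where
  "eigenline s k = {v. vertex k *v v = s *\<^sub>R v}"

lemma scaleR_rscale: "r *\<^sub>R (v \<cdot> a) = (r *\<^sub>R v) \<cdot> a"
  by (simp add: vec_eq_iff)

lemma right_subspace_eigenline: "right_subspace (eigenline s k)"
  by (simp add: right_subspace_def eigenline_def matrix_vector_right_distrib scaleR_right_distrib
      matrix_vector_rscale scaleR_rscale)

lemma acts_eigenline:
  assumes "acts g \<pi>" "k \<in> {1..6}" "v \<in> eigenline s k" shows "g *v v \<in> eigenline s (\<pi> k)"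
proof -
  have "vertex (\<pi> k) *v (g *v v) = g *v (vertex k *v v)"
    using assms(1,2) by (simp add: acts_def matrix_vector_mul_assoc)
  then show ?thesis
    using assms(3) by (simp add: eigenline_def matrix_vector_scaleR)
qed

lemma vertex_anticommutator_vec:
  assumes "j \<in> {1..6}" "k \<in> {1..6}"
  shows "vertex j *v (vertex k *v v) + vertex k *v (vertex j *v v) = (if j = k then 10 else - 2) *\<^sub>R v"
proof -
  have "mat (r *\<^sub>R 1) *v v = r *\<^sub>R v" for r
    by (simp add: vec2_eq_iff)
  then show ?thesis
    using arg_cong[OF vertex_anticommutator[OF assms], of "\<lambda>A. A *v v"]
    by (simp add: matrix_vector_mul_assoc matrix_vector_mult_add_rdistrib)
qed

text \<open>On a common eigenvector the anticommutator would act as 2 * s^2 = 10, whereas for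
  distinct vertices it acts as -2.\<close>

lemma eigenline_disjoint:
  assumes "j \<in> {1..6}" "k \<in> {1..6}" "v \<in> eigenline s j" "v \<in> eigenline s k" "v \<noteq> 0" "s\<^sup>2 = 5"
  shows "j = k"
proof (rule ccontr)
  assume "j \<noteq> k"
  then have "10 *\<^sub>R v = - 2 *\<^sub>R v"
    using vertex_anticommutator_vec[OF assms(1,2), of v] assms(3,4,6)
    by (simp add: eigenline_def matrix_vector_scaleR power2_eq_square flip: scaleR_left_distrib)
  then have "12 *\<^sub>R v = 0"
    using eq_neg_iff_add_eq_0[of "10 *\<^sub>R v" "2 *\<^sub>R v"] by (simp flip: scaleR_left_distrib)
  then show False
    using assms(5) by simp
qed

lemma qinner_vertex: "qinner (vertex k *v v) w = qinner v (vertex k *v w)"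
  by (simp add: qinner_ctrans)

lemma w_vec_eigenline: "w_vec \<in> eigenline (sqrt 5) 6"
  by (simp add: eigenline_def w_vec_def vertex_eq vec2_eq_iff quat_eq_iff sqrt_10 algebra_simps)

lemma w_perp_eigenline: "w_perp \<in> eigenline (- sqrt 5) 6"
  by (simp add: eigenline_def w_perp_def vertex_eq vec2_eq_iff quat_eq_iff sqrt_10 algebra_simps)

lemma w_nonzero: "w_vec \<noteq> 0" "w_perp \<noteq> 0"
  by (simp_all add: w_vec_def w_perp_def vec2_eq_iff quat_eq_iff)

lemma w_orthogonal: "qinner w_vec w_perp = 0"
  by (simp add: qinner_2 w_vec_def w_perp_def quat_eq_iff algebra_simps)

lemma alt_lift_transitive:
  assumes "k \<in> {1..6}"
  obtains g \<pi> where "g \<in> alt_lift 6" "acts g \<pi>" "\<pi> 6 = k"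
proof (cases "k = 6")
  case True
  then show ?thesis
    using that[OF _ acts_one] subgroup_alt_lift[of 6] by (simp add: subgroup_unitary_iff)
next
  case False
  \<comment> \<open>Any third label will do: it completes the move from 6 to \<open>k\<close> to an
    even permutation.\<close>
  define m :: nat where "m = (if k = 1 then 2 else 1)"
  have "cycle_of_list [6, k, m] \<in> carrier (alt_group 6)"
    using False assms by (intro three_cycle_in_alt_group) (auto simp: m_def)
  then obtain g where "g \<in> alt_lift 6" "acts g (cycle_of_list [6, k, m])"
    using alt_lift_surj by blast
  moreover have "cycle_of_list [6, k, m] 6 = k"
    using False by (simp add: m_def Transposition.transpose_def)
  ultimately show ?thesis
    by (rule that)
qed

lemma acts_fixing_6_in_alt_lift_5:
  assumes "g \<in> alt_lift 6" "acts g \<pi>" "\<pi> 6 = 6" shows "g \<in> alt_lift 5"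
proof -
  obtain \<rho> where \<rho>: "\<rho> \<in> carrier (alt_group 6)" "acts g \<rho>" and g: "g \<in> carrier unitary_group"
    using assms(1) by (auto simp: alt_lift_def)
  then have "\<rho> = \<pi>"
    using acts_unique assms(2) by blast
  have "x \<in> {1..5} \<or> x = 6 \<or> x \<notin> {1..6}" for x :: nat
    by auto
  then have "\<pi> permutes {1..5}"
    using assms(3) acts_permutes[OF assms(2)] unfolding permutes_def by metis
  then show ?thesis
    using \<rho> g \<open>\<rho> = \<pi>\<close> by (auto simp: alt_lift_def alt_group_carrier)
qed

lemma alt_lift_5_acts:
  assumes "g \<in> alt_lift 5" obtains \<pi> where "acts g \<pi>" "\<pi> 6 = 6"
proof -
  obtain \<pi> where "\<pi> permutes {1..5}" "acts g \<pi>"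
    using assms by (auto simp: alt_lift_def alt_group_carrier)
  then show ?thesis
    using that permutes_not_in[of \<pi> "{1..5}" 6] by auto
qed

text \<open>One development for both orbits: s = sqrt 5 with \<open>w_vec\<close> and s = -sqrt 5
  with \<open>w_perp\<close>. Signs never enter, only the square of \<open>s\<close>.\<close>

locale free_eigenvector =
  fixes s :: real and u :: "quat ^ 2"
  assumes s: "s\<^sup>2 = 5" and u: "u \<in> eigenline s 6" "u \<noteq> 0"
    and free: "g \<in> alt_lift 6 \<Longrightarrow> g *v u = u \<Longrightarrow> g = mat 1"
begin

lemma eigenline_6: "eigenline s 6 = right_span {u}"
proof (rule right_subspace_line[OF right_subspace_eigenline u])
  \<comment> \<open>The off-diagonal entries of \<open>vertex 6\<close> are nonzero.\<close>
  have "vector [1, 0] \<notin> eigenline s 6"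
    by (simp add: eigenline_def vertex_eq vec2_eq_iff quat_eq_iff)
  then show "eigenline s 6 \<noteq> UNIV"
    by blast
qed

lemma eigenline_eq:
  assumes "g \<in> carrier unitary_group" "acts g \<pi>" "\<pi> 6 = k" shows "eigenline s k = right_span {g *v u}"
proof
  have gu: "g *v u \<in> eigenline s k"
    using acts_eigenline[OF assms(2) _ u(1)] assms(3) by simp
  then show "right_span {g *v u} \<subseteq> eigenline s k"
    by (intro right_span_minimal right_subspace_eigenline) simp
  show "eigenline s k \<subseteq> right_span {g *v u}"
  proof
    fix v assume v: "v \<in> eigenline s k"
    have "inv' \<pi> k = 6"
      using assms(3) permutes_inverses(2)[OF acts_permutes[OF assms(2)]] by metis
    moreover have "k \<in> {1..6}"
      using acts_in_iff[OF assms(2), of 6] assms(3) by simp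
    ultimately have "ctrans g *v v \<in> right_span {u}"
      using acts_eigenline[OF acts_ctrans[OF assms(1,2)] _ v] eigenline_6 by simp
    then obtain a where "ctrans g *v v = u \<cdot> a"
      by (auto simp: right_span_singleton)
    then have "v = (g *v u) \<cdot> a"
      using unitary_cancel(6)[OF assms(1), of v] by (simp add: matrix_vector_rscale)
    then show "v \<in> right_span {g *v u}"
      by (simp add: in_right_span_singleton)
  qed
qed

lemma image_nonzero: "g \<in> alt_lift 6 \<Longrightarrow> g *v u \<noteq> 0"
  using u(2) unitary_cancel(5)[of g u] by (auto simp: alt_lift_def)

lemma inj_on_orbit: "inj_on (\<lambda>g. g *v u) (alt_lift 6)"
proof (rule inj_onI)
  fix g h assume gh: "g \<in> alt_lift 6" "h \<in> alt_lift 6" "g *v u = h *v u"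
  then have U: "g \<in> carrier unitary_group" "h \<in> carrier unitary_group"
    by (simp_all add: alt_lift_def)
  have "(ctrans h ** g) *v u = u"
    using gh(3) unitary_cancel(5)[OF U(2)] by (simp flip: matrix_vector_mul_assoc)
  moreover have "ctrans h ** g \<in> alt_lift 6"
    using gh(1,2) subgroup_alt_lift[of 6] by (simp add: subgroup_unitary_iff)
  ultimately have "ctrans h ** g = mat 1"
    by (intro free)
  then have "h ** (ctrans h ** g) = h"
    by simp
  then show "g = h"
    using unitary_cancel(4)[OF U(2)] by simp
qed

lemma card_orbit: "card (orbit_of (alt_lift 6) u) = 720"
  using card_image[OF inj_on_orbit] card_alt_lift[of 6] by (simp add: orbit_of_def fact_numeral)

lemma eigenline_nonzero:
  assumes "k \<in> {1..6}" obtains v where "v \<noteq> 0" "eigenline s k = right_span {v}"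
proof -
  obtain g \<pi> where g: "g \<in> alt_lift 6" "acts g \<pi>" "\<pi> 6 = k"
    using alt_lift_transitive[OF assms] .
  then show ?thesis
    using that[OF image_nonzero[OF g(1)]] eigenline_eq[OF _ g(2,3)] by (simp add: alt_lift_def)
qed

lemma inj_on_eigenline: "inj_on (eigenline s) {1..6}"
proof (rule inj_onI)
  fix j k :: nat assume jk: "j \<in> {1..6}" "k \<in> {1..6}" "eigenline s j = eigenline s k"
  obtain v where "v \<noteq> 0" "eigenline s j = right_span {v}"
    using eigenline_nonzero[OF jk(1)] .
  then show "j = k"
    using eigenline_disjoint[OF jk(1,2), of v s] jk(3) in_right_span_singleton(2)[of v] s by auto
qed

lemma orbit_subset: "orbit_of (alt_lift 6) u \<subseteq> \<Union> (eigenline s ` {1..6})"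
proof -
  have "g *v u \<in> \<Union> (eigenline s ` {1..6})" if g: "g \<in> alt_lift 6" for g
  proof -
    obtain \<pi> where \<pi>: "acts g \<pi>"
      using g by (auto simp: alt_lift_def)
    then show ?thesis
      using acts_eigenline[OF \<pi> _ u(1)] acts_in_iff[OF \<pi>, of 6] by auto
  qed
  then show ?thesis
    by (auto simp: orbit_of_def)
qed

text \<open>If \<open>g\<close> moves vertex 6 to \<open>k\<close>, the orbit vectors on line
  \<open>k\<close> come exactly from the coset of \<open>alt_lift 5\<close> by \<open>g\<close>;
  freeness makes the count its order 120.\<close>

lemma card_orbit_eigenline:
  assumes "k \<in> {1..6}" shows "card (orbit_of (alt_lift 6) u \<inter> eigenline s k) = 120"
proof -
  obtain g \<pi> where g: "g \<in> alt_lift 6" "acts g \<pi>" "\<pi> 6 = k"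
    using alt_lift_transitive[OF assms] .
  have U: "g \<in> carrier unitary_group"
    using g(1) by (simp add: alt_lift_def)
  have sub: "x ** y \<in> alt_lift 6" "ctrans x \<in> alt_lift 6" if "x \<in> alt_lift 6" "y \<in> alt_lift 6" for x y
    using that subgroup_alt_lift[of 6] by (simp_all add: subgroup_unitary_iff)
  let ?f = "\<lambda>h. (g ** h) *v u"
  have "orbit_of (alt_lift 6) u \<inter> eigenline s k = ?f ` alt_lift 5"
  proof
    show "?f ` alt_lift 5 \<subseteq> orbit_of (alt_lift 6) u \<inter> eigenline s k"
    proof (rule image_subsetI)
      fix h assume h: "h \<in> alt_lift 5"
      then obtain \<rho> where \<rho>: "acts h \<rho>" "\<rho> 6 = 6"
        by (rule alt_lift_5_acts)
      have "g ** h \<in> alt_lift 6"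
        using sub(1)[OF g(1)] alt_lift_mono[of 5 6] h by auto
      moreover have "?f h \<in> eigenline s k"
        using acts_eigenline[OF acts_mult[OF g(2) \<rho>(1)] _ u(1)] \<rho>(2) g(3) by simp
      ultimately show "?f h \<in> orbit_of (alt_lift 6) u \<inter> eigenline s k"
        by (auto simp: orbit_of_def)
    qed
    show "orbit_of (alt_lift 6) u \<inter> eigenline s k \<subseteq> ?f ` alt_lift 5"
    proof
      fix x assume x: "x \<in> orbit_of (alt_lift 6) u \<inter> eigenline s k"
      then obtain h where h: "h \<in> alt_lift 6" "x = h *v u"
        by (auto simp: orbit_of_def)
      have mem: "ctrans g ** h \<in> alt_lift 6"
        using sub g(1) h(1) by blast
      then obtain \<rho> where \<rho>: "acts (ctrans g ** h) \<rho>"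
        by (auto simp: alt_lift_def)
      have gk: "inv' \<pi> k = 6"
        using g(3) permutes_inverses(2)[OF acts_permutes[OF g(2)]] by metis
      have "ctrans g *v x \<in> eigenline s 6"
        using acts_eigenline[OF acts_ctrans[OF U g(2)] assms] x gk by simp
      moreover have "ctrans g *v x \<in> eigenline s (\<rho> 6)"
        using acts_eigenline[OF \<rho> _ u(1)] by (simp add: h(2) matrix_vector_mul_assoc)
      moreover have "ctrans g *v x \<noteq> 0"
        using image_nonzero[OF mem] by (simp add: h(2) matrix_vector_mul_assoc)
      ultimately have "\<rho> 6 = 6"
        using eigenline_disjoint[of "\<rho> 6" 6 _ s] acts_in_iff[OF \<rho>, of 6] s by simp
      then have "ctrans g ** h \<in> alt_lift 5"
        using acts_fixing_6_in_alt_lift_5[OF mem \<rho>] by simp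
      moreover have "x = ?f (ctrans g ** h)"
        by (simp add: h(2) unitary_cancel(4)[OF U])
      ultimately show "x \<in> ?f ` alt_lift 5"
        by blast
    qed
  qed
  moreover have "inj_on ?f (alt_lift 5)"
  proof (rule inj_onI)
    fix x y assume xy: "x \<in> alt_lift 5" "y \<in> alt_lift 5" "?f x = ?f y"
    then have "x \<in> alt_lift 6" "y \<in> alt_lift 6"
      using alt_lift_mono[of 5 6] by auto
    then have "g ** x = g ** y"
      using inj_onD[OF inj_on_orbit xy(3)] sub(1)[OF g(1)] by blast
    then show "x = y"
      using unitary_cancel(3)[OF U] by metis
  qed
  ultimately show ?thesis
    using card_alt_lift[of 5] by (simp add: card_image fact_numeral)
qed

text \<open>For \<open>w\<close> on the line \<open>k\<close>, the vector \<open>w + s\<inverse> V\<^sub>j w\<close> is twice the projection of \<open>w\<close> to the line \<open>j\<close>,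
  and the anticommutator of \<open>V\<^sub>j\<close> and \<open>V\<^sub>k\<close> computes its inner product with \<open>w\<close>.\<close>

lemma qinner_eigenlines:
  assumes jk: "j \<in> {1..6}" "k \<in> {1..6}" "j \<noteq> k"
    and vw: "qinner v v = 1" "qinner w w = 1" "right_span {v} = eigenline s j" "right_span {w} = eigenline s k"
  shows "(norm (qinner v w))\<^sup>2 = 2 / 5"
proof -
  have s0: "s \<noteq> 0"
    using s by auto
  then have s1: "5 / s = s"
    using s by (simp add: divide_eq_eq power2_eq_square)
  have V: "vertex j *v v = s *\<^sub>R v" "vertex k *v w = s *\<^sub>R w"
    using in_right_span_singleton(2)[of v] in_right_span_singleton(2)[of w] vw(3,4) by (auto simp: eigenline_def)
  have Vjj: "vertex j *v (vertex j *v x) = 5 *\<^sub>R x" for x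
  proof -
    have "2 *\<^sub>R (vertex j *v (vertex j *v x)) = 2 *\<^sub>R (5 *\<^sub>R x)"
      using vertex_anticommutator_vec[OF jk(1,1), of x] by (simp add: scaleR_2)
    then show ?thesis
      by (simp only: scaleR_cancel_left) simp
  qed
  define y where "y = w + (1 / s) *\<^sub>R (vertex j *v w)"
  have "vertex j *v y = s *\<^sub>R y"
    using s0 s1 by (simp add: y_def matrix_vector_right_distrib matrix_vector_scaleR Vjj scaleR_right_distrib)
  then obtain a where a: "y = v \<cdot> a"
    using vw(3) by (auto simp: eigenline_def right_span_singleton)
  have "qinner v y = 2 *\<^sub>R qinner v w"
    using s0 by (simp add: y_def qinner_simps scaleR_2 V flip: qinner_vertex)
  then have "a = 2 *\<^sub>R qinner v w"
    using a vw(1) by (simp add: qinner_simps)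
  then have "qinner w y = 2 *\<^sub>R (qcnj (qinner v w) * qinner v w)"
    by (simp add: a qinner_simps qcnj_qinner)
  then have 1: "qinner w y = (2 * (norm (qinner v w))\<^sup>2) *\<^sub>R 1"
    by (simp add: qcnj_mult_self)
  have "qinner w (vertex j *v (vertex k *v w) + vertex k *v (vertex j *v w)) = (2 * s) *\<^sub>R qinner w (vertex j *v w)"
    by (simp add: V qinner_simps matrix_vector_scaleR flip: qinner_vertex[of k] scaleR_left_distrib)
  then have "(2 * s) *\<^sub>R qinner w (vertex j *v w) = (- 2) *\<^sub>R 1"
    unfolding vertex_anticommutator_vec[OF jk(1,2)] using jk(3) vw(2) by (simp add: qinner_simps)
  then have "(1 / (2 * s)) *\<^sub>R ((2 * s) *\<^sub>R qinner w (vertex j *v w)) = (1 / (2 * s)) *\<^sub>R ((- 2) *\<^sub>R 1)"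
    by (simp only:)
  then have "qinner w (vertex j *v w) = (- 1 / s) *\<^sub>R 1"
    using s0 by simp
  \<comment> \<open>This value 1 - 1/5 is twice the squared modulus sought, whence 2/5.\<close>
  then have "qinner w y = (1 - 1 / s\<^sup>2) *\<^sub>R 1"
    by (simp add: y_def qinner_simps vw(2) power2_eq_square scaleR_left_diff_distrib)
  then show ?thesis
    using 1 s by simp
qed

lemma equiangular_eigenlines: "equiangular (eigenline s ` {1..6})"
  unfolding equiangular_def
proof (intro conjI ballI exI[of _ "2 / 5"] impI allI)
  fix L assume "L \<in> eigenline s ` {1..6}"
  then obtain k where "k \<in> {1..6}" "L = eigenline s k"
    by blast
  then show "is_line L"
    using eigenline_nonzero[of k] is_line_right_span by metis
next
  fix L M v w
  assume LM: "L \<in> eigenline s ` {1..6}" "M \<in> eigenline s ` {1..6}" "L \<noteq> M"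
    and *: "qinner v v = 1 \<and> qinner w w = 1 \<and> right_span {v} = L \<and> right_span {w} = M"
  obtain j k where "j \<in> {1..6}" "L = eigenline s j" "k \<in> {1..6}" "M = eigenline s k"
    using LM(1,2) by blast
  then show "(norm (qinner v w))\<^sup>2 = 2 / 5"
    using LM(3) * by (intro qinner_eigenlines[of j k]) auto
qed

lemma orbit_in_equiangular_lines:
  "\<exists>\<L>. card \<L> = 6 \<and> equiangular \<L> \<and> orbit_of (alt_lift 6) u \<subseteq> \<Union>\<L> \<and>
     (\<forall>L\<in>\<L>. card (orbit_of (alt_lift 6) u \<inter> L) = 120)"
proof (intro exI conjI ballI)
  show "card (eigenline s ` {1..6}) = 6"
    using card_image[OF inj_on_eigenline] by simp
qed (use equiangular_eigenlines orbit_subset card_orbit_eigenline in auto)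

lemma alt_lift_5_image:
  assumes "h \<in> alt_lift 5" shows "h *v u \<in> right_span {u}"
proof -
  obtain \<pi> where "acts h \<pi>" "\<pi> 6 = 6"
    using assms by (rule alt_lift_5_acts)
  then show ?thesis
    using acts_eigenline[of h \<pi> 6 u s] u(1) eigenline_6 by simp
qed

lemma fixes_line: "h \<in> alt_lift 5 \<Longrightarrow> fixes_line h u"
  using alt_lift_5_image by (auto simp: fixes_line_def right_span_singleton)

lemma submodule_of_line: "submodule_of (alt_lift 5) (right_span {u})"
  unfolding submodule_of_def invariant_def
proof (intro conjI ballI right_subspace_span_singleton)
  fix g v assume "g \<in> alt_lift 5" "v \<in> right_span {u}"
  then show "g *v v \<in> right_span {u}"
    using right_subspaceD(3)[OF right_subspace_span_singleton alt_lift_5_image[of g]]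
    by (auto simp: right_span_singleton matrix_vector_rscale)
qed

lemma faithful_on_line: "faithful_on (alt_lift 5) (right_span {u})"
  using free alt_lift_mono[of 5 6] in_right_span_singleton(2)[of u] by (auto simp: faithful_on_def)

end

interpretation W: free_eigenvector "sqrt 5" w_vec
  by unfold_locales (simp_all add: w_vec_eigenline w_nonzero stabilizer_w_vec)

interpretation W_perp: free_eigenvector "- sqrt 5" w_perp
  by unfold_locales (simp_all add: w_perp_eigenline w_nonzero stabilizer_w_perp)

section \<open>The decomposition of the plane\<close>

text \<open>Here \<open>a\<close> is the conjugate of \<open>c\<close> by \<open>x\<close>; the real
  part is the invariant that remains of a right eigenvalue when the spanning vector is
  rescaled.\<close>

lemma QRe_conjugate:
  assumes "a * x = x * c" "x \<noteq> 0" shows "QRe a = QRe c"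
proof -
  have "(norm x)\<^sup>2 *\<^sub>R a = x * c * qcnj x"
    by (simp add: qcnj_mult_self mult.assoc flip: assms(1))
  moreover have "QRe (x * c * qcnj x) = (norm x)\<^sup>2 * QRe c"
    by (simp add: quat_norm_sq) (simp add: power2_eq_square algebra_simps)
  ultimately have "(norm x)\<^sup>2 * QRe a = (norm x)\<^sup>2 * QRe c"
    by (metis scaleR_quat.sel(1))
  then show ?thesis
    using assms(2) by simp
qed

lemma submodule_of_line_irreducible:
  assumes "submodule_of H (right_span {u})" "u \<noteq> 0" shows "irreducible_submodule H (right_span {u})"
  unfolding irreducible_submodule_def
proof (intro conjI allI impI)
  fix T assume T: "submodule_of H T \<and> T \<subseteq> right_span {u}"
  show "T = {0} \<or> T = right_span {u}"
  proof (cases "T = {0}")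
    case False
    moreover have "0 \<in> T"
      using T by (simp add: submodule_of_def right_subspaceD(1))
    ultimately obtain v where "v \<in> T" "v \<noteq> 0"
      by blast
    then have "right_span {u} \<subseteq> T"
      using T right_span_singleton_eq[of v u] right_span_minimal[of "{v}" T] by (auto simp: submodule_of_def)
    then show ?thesis
      using T by blast
  qed simp
qed (use assms right_span_singleton_nonzero in auto)

text \<open>A group element acting on two orthogonal invariant lines by scalars with distinct real parts tells the
  lines apart, since conjugate quaternions have the same real part.\<close>

locale distinguished_lines =
  fixes H :: "(quat ^ 2 ^ 2) set" and u u' :: "quat ^ 2" and h :: "quat ^ 2 ^ 2" and a b :: quat
  assumes nonzero: "u \<noteq> 0" "u' \<noteq> 0" and orth: "qinner u u' = 0"
    and sub: "submodule_of H (right_span {u})" "submodule_of H (right_span {u'})"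
    and h: "h \<in> H" "h *v u = u \<cdot> a" "h *v u' = u' \<cdot> b" and QRe_neq: "QRe a \<noteq> QRe b"
begin

lemma not_in_line: "u' \<notin> right_span {u}"
proof
  assume "u' \<in> right_span {u}"
  then have "qinner u' u' = 0"
    using orth nonzero(1) by (auto simp: right_span_singleton qinner_simps)
  then show False
    using nonzero(2) by simp
qed

text \<open>For an invariant line through u x + u' y with scalar c, comparing components gives a x =
  x c and b y = y c. If x and y were both nonzero, a and b would share the real part of c.\<close>

lemma submodule_cases:
  assumes S: "submodule_of H S" "S \<noteq> {0}" "S \<noteq> UNIV" shows "S = right_span {u} \<or> S = right_span {u'}"
proof -
  have S': "right_subspace S"
    using S(1) by (simp add: submodule_of_def)
  then obtain v where v: "v \<in> S" "v \<noteq> 0"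
    using S(2) right_subspaceD(1) by blast
  then have S_eq: "S = right_span {v}"
    using right_subspace_line S' S(3) by blast
  have "h *v v \<in> right_span {v}"
    using v(1) S(1) h(1) unfolding S_eq by (auto simp: submodule_of_def invariant_def)
  then obtain c where c: "h *v v = v \<cdot> c"
    by (auto simp: right_span_singleton)
  obtain x y where xy: "v = u \<cdot> x + u' \<cdot> y"
    using plane_spanned_by_two[OF nonzero(1) not_in_line] .
  have eq: "u \<cdot> (a * x) + u' \<cdot> (b * y) = u \<cdot> (x * c) + u' \<cdot> (y * c)"
    using c by (simp add: xy matrix_vector_right_distrib matrix_vector_rscale h)
  have "qinner u' u = 0"
    using orth by (metis qcnj_qinner qcnj_eq_0_iff)
  then have "qinner u u * (a * x) = qinner u u * (x * c)" "qinner u' u' * (b * y) = qinner u' u' * (y * c)"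
    using arg_cong[OF eq, of "qinner u"] arg_cong[OF eq, of "qinner u'"] orth
    by (simp_all add: qinner_simps del: rscale_simps)
  then have "a * x = x * c" "b * y = y * c"
    using nonzero by simp_all
  then have "x = 0 \<or> y = 0"
    using QRe_neq QRe_conjugate by metis
  then have "v \<in> right_span {u} \<or> v \<in> right_span {u'}"
    using in_right_span_singleton(1)[of u x] in_right_span_singleton(1)[of u' y] by (auto simp: xy)
  then show ?thesis
    using right_span_singleton_eq v(2) S_eq by blast
qed

text \<open>An isomorphism sends \<open>u\<close> to u' c with c nonzero, and equivariance under
  \<open>h\<close> reads b c = c a, so that a and b would be conjugate.\<close>

lemma not_isomorphic: "\<not> isomorphic_submodules H (right_span {u}) (right_span {u'})"
proof
  assume "isomorphic_submodules H (right_span {u}) (right_span {u'})"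
  then obtain \<phi> where bij: "bij_betw \<phi> (right_span {u}) (right_span {u'})"
    and add: "\<forall>v\<in>right_span {u}. \<forall>w\<in>right_span {u}. \<phi> (v + w) = \<phi> v + \<phi> w"
    and scale: "\<forall>v\<in>right_span {u}. \<forall>a. \<phi> (v \<cdot> a) = \<phi> v \<cdot> a"
    and equivariant: "\<forall>g\<in>H. \<forall>v\<in>right_span {u}. \<phi> (g *v v) = g *v \<phi> v"
    unfolding isomorphic_submodules_def by blast
  have mem: "u \<in> right_span {u}" "0 \<in> right_span {u}"
    using in_right_span_singleton[of u] right_subspaceD(1)[OF right_subspace_span_singleton] by auto
  have "\<phi> u \<in> right_span {u'}"
    using bij_betwE[OF bij] mem(1) by blast
  then obtain c where c: "\<phi> u = u' \<cdot> c"
    unfolding right_span_singleton by blast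
  have "\<phi> 0 = 0"
    using add mem(2) by force
  then have "c \<noteq> 0"
    using c inj_onD[OF bij_betw_imp_inj_on[OF bij], of u 0] mem nonzero(1) by auto
  have "u' \<cdot> (c * a) = u' \<cdot> (b * c)"
    using scale equivariant mem(1) h c by (metis matrix_vector_rscale rscale_simps(7))
  then have "u' \<cdot> (b * c - c * a) = 0"
    by (auto simp: vec_eq_iff algebra_simps)
  then have "b * c = c * a"
    using nonzero(2) by simp
  then show False
    using QRe_conjugate \<open>c \<noteq> 0\<close> QRe_neq by metis
qed

text \<open>A submodule isomorphic to the line is spanned by the image of \<open>u\<close>, so it is
  proper and nonzero and hence one of the two lines; the other one is excluded by
  non-isomorphism.\<close>

lemma homogeneous_component_line: "homogeneous_component H (right_span {u}) = right_span {u}"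
proof -
  let ?S = "right_span {u}"
  have "isomorphic_submodules H ?S ?S"
    unfolding isomorphic_submodules_def by (rule exI[of _ id]) auto
  moreover have "T = ?S" if T: "submodule_of H T" "isomorphic_submodules H ?S T" for T
  proof -
    obtain \<phi> where bij: "bij_betw \<phi> ?S T" and scale: "\<forall>v\<in>?S. \<forall>a. \<phi> (v \<cdot> a) = \<phi> v \<cdot> a"
      using T(2) unfolding isomorphic_submodules_def by blast
    have "T = range (\<lambda>a. \<phi> (u \<cdot> a))"
      using bij_betw_imp_surj_on[OF bij] by (auto simp: right_span_singleton)
    also have "\<dots> = right_span {\<phi> u}"
      using scale in_right_span_singleton(2)[of u] by (simp add: right_span_singleton[of "\<phi> u"])
    finally have "T \<noteq> UNIV"
      using right_span_singleton_neq_UNIV by simp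
    moreover have "T \<noteq> {0}"
    proof
      assume "T = {0}"
      then have "\<phi> u = \<phi> (u \<cdot> 0)"
        using bij_betwE[OF bij] in_right_span_singleton[of u] by (metis singletonD)
      then have "u = u \<cdot> 0"
        using bij_betw_imp_inj_on[OF bij] in_right_span_singleton[of u] by (metis inj_onD)
      then show False
        using nonzero(1) by simp
    qed
    ultimately show ?thesis
      using submodule_cases[OF T(1)] T(2) not_isomorphic by blast
  qed
  ultimately have "{T. submodule_of H T \<and> isomorphic_submodules H ?S T} = {?S}"
    using sub(1) by blast
  then show ?thesis
    by (simp add: homogeneous_component_def right_span_subspace right_subspace_span_singleton)
qed

lemma irreducible_submodule_iff:
  "irreducible_submodule H S \<longleftrightarrow> S = right_span {u} \<or> S = right_span {u'}"
proof
  assume S: "irreducible_submodule H S"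
  have "S \<noteq> UNIV"
    using S sub(1) right_span_singleton_nonzero[OF nonzero(1)] right_span_singleton_neq_UNIV
    by (auto simp: irreducible_submodule_def)
  then show "S = right_span {u} \<or> S = right_span {u'}"
    using S submodule_cases by (simp add: irreducible_submodule_def)
qed (use submodule_of_line_irreducible sub nonzero in blast)

end

text \<open>The generator \<open>b3\<close> could not separate the lines: it squares to -1, so its
  scalars are purely imaginary. For \<open>g2\<close> the signs of the real parts suffice.\<close>

lemma g2_scalars:
  obtains a b where "g2 *v w_vec = w_vec \<cdot> a" "g2 *v w_perp = w_perp \<cdot> b" "QRe a \<noteq> QRe b"
proof -
  have "g2 \<in> alt_lift 5"
    by (auto simp flip: generate_eq_alt_lift_5 intro: generate.incl)
  then have "fixes_line g2 w_vec" "fixes_line g2 w_perp"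
    by (rule W.fixes_line W_perp.fixes_line)+
  then obtain a b where ab: "g2 *v w_vec = w_vec \<cdot> a" "g2 *v w_perp = w_perp \<cdot> b"
    unfolding fixes_line_def by blast
  have pos: "sqrt 2 + sqrt 10 > 0"
    by (simp add: add_pos_pos)
  \<comment> \<open>The coordinate with a real entry exposes the scalar: the first for
    \<open>w_vec\<close>, the second for \<open>w_perp\<close>. The values are (sqrt 5 - 1) / 4 and
    -(sqrt 5 + 1) / 4, the cosines of 72 and 144 degrees.\<close>
  have "(sqrt 2 + sqrt 10) * QRe a = sqrt 2"
    using arg_cong[OF ab(1), of "\<lambda>v. QRe (v $ 1)"]
    by (simp add: w_vec_def generators_sqrt algebra_simps)
  then have "QRe a > 0"
    using pos by (metis real_sqrt_gt_0_iff zero_less_mult_pos zero_less_numeral)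
  moreover have "(sqrt 2 + sqrt 10) * QRe b = - (sqrt 2 + (sqrt 2 + sqrt 10) / 2)"
    using arg_cong[OF ab(2), of "\<lambda>v. QRe (v $ 2)"]
    by (simp add: w_perp_def generators_sqrt field_simps)
  then have "(sqrt 2 + sqrt 10) * QRe b < 0"
    using pos by (simp add: add_pos_pos)
  then have "QRe b < 0"
    using pos by (simp add: mult_less_0_iff)
  ultimately show ?thesis
    using that ab by force
qed

theorem theorem5p1:
  fixes G H :: "(quat ^ 2 ^ 2) set"
  assumes G_def: "G = generate unitary_group {b1, b2, b3, b4}"
    and H_def: "H = generate unitary_group {b3, g2}"
  shows
    "({b1, b2, b3, b4} \<subseteq> carrier unitary_group \<and> subgroup G unitary_group \<and>
      card G = 720 \<and> is_reflection_group G \<and> primitive_group G \<and>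
      is_double_cover_alt 6 (unitary_subgroup G)) \<and>
     (subgroup H (unitary_subgroup G) \<and> card H = 120 \<and> \<not> irreducible_group H \<and>
      is_double_cover_alt 5 (unitary_subgroup H)) \<and>
     qinner w_vec w_perp = 0 \<and>
     (\<forall>u\<in>{w_vec, w_perp}.
        card (orbit_of G u) = 720 \<and>
        (\<exists>\<L>. card \<L> = 6 \<and> equiangular \<L> \<and> orbit_of G u \<subseteq> \<Union>\<L> \<and>
             (\<forall>L\<in>\<L>. card (orbit_of G u \<inter> L) = 120)) \<and>
        (\<forall>h\<in>H. fixes_line h u) \<and>
        faithful_on H (right_span {u}) \<and>
        irreducible_submodule H (right_span {u})) \<and>
     orthogonal_sets (right_span {w_vec}) (right_span {w_perp}) \<and>
     is_direct_sum {right_span {w_vec}, right_span {w_perp}} UNIV \<and>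
     \<not> isomorphic_submodules H (right_span {w_vec}) (right_span {w_perp}) \<and>
     homogeneous_components H = {right_span {w_vec}, right_span {w_perp}}"
proof -
  have G: "G = alt_lift 6" and H: "H = alt_lift 5"
    using assms generate_eq_alt_lift_6 generate_eq_alt_lift_5 by simp_all
  have b: "b1 \<in> G" "b2 \<in> G"
    by (auto simp: G_def intro: generate.incl)
  have g2: "g2 \<in> H"
    by (auto simp: H_def intro: generate.incl)
  obtain a b where ab: "g2 *v w_vec = w_vec \<cdot> a" "g2 *v w_perp = w_perp \<cdot> b" "QRe a \<noteq> QRe b"
    by (rule g2_scalars)
  interpret L: distinguished_lines H w_vec w_perp g2 a b
    using w_nonzero w_orthogonal W.submodule_of_line W_perp.submodule_of_line g2 ab
    by unfold_locales (simp_all add: H)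
  have "qinner w_perp w_vec = 0"
    using w_orthogonal by (metis qcnj_qinner qcnj_eq_0_iff)
  \<comment> \<open>The same data with the lines exchanged, which gives the homogeneous component of
    the second line.\<close>
  then interpret L': distinguished_lines H w_perp w_vec g2 b a
    using w_nonzero W.submodule_of_line W_perp.submodule_of_line g2 ab
    by unfold_locales (simp_all add: H)
  have "subgroup H (unitary_subgroup G)"
    unfolding G H by (rule U.subgroup_incl[OF subgroup_alt_lift subgroup_alt_lift]) (simp add: alt_lift_mono)
  moreover have "\<not> irreducible_group H"
    using L.sub(1) right_span_singleton_nonzero[OF w_nonzero(1)] right_span_singleton_neq_UNIV
    unfolding irreducible_group_def submodule_of_def by blast
  moreover have "card G = 720" "card H = 120"
    using card_alt_lift[of 6] card_alt_lift[of 5] by (simp_all add: G H fact_numeral)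
  moreover have "orthogonal_sets (right_span {w_vec}) (right_span {w_perp})"
    using w_orthogonal by (auto simp: orthogonal_sets_def right_span_singleton qinner_simps)
  moreover have "homogeneous_components H = {right_span {w_vec}, right_span {w_perp}}"
    unfolding homogeneous_components_def L.irreducible_submodule_iff
    using L.homogeneous_component_line L'.homogeneous_component_line by auto
  moreover have "irreducible_submodule H (right_span {w_vec})" "irreducible_submodule H (right_span {w_perp})"
    by (simp_all add: L.irreducible_submodule_iff)
  ultimately show ?thesis
    using generators_unitary subgroup_alt_lift is_reflection_group_alt_lift_6 primitive_b1_b2[OF b]
      double_cover_alt_lift[of 6] double_cover_alt_lift[of 5] w_orthogonal
      W.card_orbit W_perp.card_orbit W.orbit_in_equiangular_lines W_perp.orbit_in_equiangular_lines
      W.fixes_line W_perp.fixes_line W.faithful_on_line W_perp.faithful_on_line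
      direct_sum_of_orthogonal_lines[OF w_nonzero w_orthogonal] L.not_isomorphic
    unfolding G H by simp
qed

end
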